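(* Let $\mathbb K\in\{\mathbb R,\mathbb C,\mathbb H\}$, let $p$ be a positive integer, and let $E,F,E',F'\in X_p(\mathbb K)$. There exists $g\in\mathbf O_{p,\infty}(\mathbb K)$ such that $g(E)=E'$ and $g(F)=F'$ if and only if the pairs $E,F$ and $E',F'$ have the same families of hyperbolic principal angles.
   Context: Let $\mathcal H$ be a separable infinite-dimensional right $\mathbb K$-Hilbert space with form $\langle\cdot,\cdot\rangle$ (so $\langle x,y\lambda+z\rangle=\langle x,y\rangle\lambda+\langle x,z\rangle$, $\langle x,y\rangle=\overline{\langle y,x\rangle}$). Fix a $\mathbb K$-subspace $E_0$ of dimension $p$, let $\Phi=\mathrm{Id}$ on $E_0$ and $-\mathrm{Id}$ on $E_0^\perp$, $B(x,y)=\langle x,\Phi y\rangle$, $Q(x)=B(x,x)$. $X_p(\mathbb K)$ is the set of $p$-dimensional $\mathbb K$-subspaces $E$ of $\mathcal H$ with $B|_{E\times E}$ positive definite. $\mathbf O_{p,\infty}(\mathbb K)$ is the group of invertible bounded $\mathbb K$-linear operators $g$ of $\mathcal H$ with $g^*\Phi g=\Phi$. Hyperbolic principal angles between $E,F\in X_p(\mathbb K)$: set $E_{(0)}=E$, $F_{(0)}=F$. Inductively for $l=0,\dots,p-1$ let $c_{l+1}=\sup\{\mathrm{Re}\,B(x,y): x\in E_{(l)},\,y\in F_{(l)},\,Q(x)=Q(y)=1\}$, choose $x_{l+1}\in E_{(l)}$, $y_{l+1}\in F_{(l)}$ with $Q(x_{l+1})=Q(y_{l+1})=1$ and $B(x_{l+1},y_{l+1})=c_{l+1}$,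 and let $E_{(l+1)}$, $F_{(l+1)}$ be the $B$-orthogonals of $\{x_1,\dots,x_{l+1}\}$ in $E$ and of $\{y_1,\dots,y_{l+1}\}$ in $F$. The numbers $c_i$ do not depend on the choices and satisfy $c_i\ge1$; the family of hyperbolic principal angles is $(\alpha_1,\dots,\alpha_p)$ with $\alpha_i=\mathrm{arccosh}(c_i)\ge0$ (a non-increasing family). *)

theory Defs
  imports "HOL-Analysis.Analysis"
begin

section \<open>Quaternions\<close>

text \<open>\<open>Quat a b c d\<close> is the quaternion \<open>a + b i + c j + d k\<close>.\<close>

codatatype quat = Quat (qRe: real) (qI: real) (qJ: real) (qK: real)

lemma quat_eqI: "qRe x = qRe y \<Longrightarrow> qI x = qI y \<Longrightarrow> qJ x = qJ y \<Longrightarrow> qK x = qK y \<Longrightarrow> x = y"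
  by (rule quat.expand) simp

lemma quat_eq_iff: "x = y \<longleftrightarrow> qRe x = qRe y \<and> qI x = qI y \<and> qJ x = qJ y \<and> qK x = qK y"
  by (auto intro: quat_eqI)

instantiation quat :: ab_group_add
begin

primcorec zero_quat where
  "qRe 0 = 0" | "qI 0 = 0" | "qJ 0 = 0" | "qK 0 = 0"

primcorec plus_quat where
  "qRe (x + y) = qRe x + qRe y"
| "qI (x + y) = qI x + qI y"
| "qJ (x + y) = qJ x + qJ y"
| "qK (x + y) = qK x + qK y"

primcorec uminus_quat where
  "qRe (- x) = - qRe x"
| "qI (- x) = - qI x"
| "qJ (- x) = - qJ x"
| "qK (- x) = - qK x"

primcorec minus_quat where
  "qRe (x - y) = qRe x - qRe y"
| "qI (x - y) = qI x - qI y"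
| "qJ (x - y) = qJ x - qJ y"
| "qK (x - y) = qK x - qK y"

instance
  by standard (simp_all add: quat_eq_iff)

end

instantiation quat :: ring_1
begin

primcorec one_quat where
  "qRe 1 = 1" | "qI 1 = 0" | "qJ 1 = 0" | "qK 1 = 0"

primcorec times_quat where
  "qRe (x * y) = qRe x * qRe y - qI x * qI y - qJ x * qJ y - qK x * qK y"
| "qI (x * y) = qRe x * qI y + qI x * qRe y + qJ x * qK y - qK x * qJ y"
| "qJ (x * y) = qRe x * qJ y - qI x * qK y + qJ x * qRe y + qK x * qI y"
| "qK (x * y) = qRe x * qK y + qI x * qJ y - qJ x * qI y + qK x * qRe y"

instance
  by standard (simp_all add: quat_eq_iff algebra_simps)

end

instantiation quat :: real_algebra_1
begin

primcorec scaleR_quat where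
  "qRe (scaleR r x) = r * qRe x"
| "qI (scaleR r x) = r * qI x"
| "qJ (scaleR r x) = r * qJ x"
| "qK (scaleR r x) = r * qK x"

instance
  by standard (simp_all add: quat_eq_iff algebra_simps)

end

instantiation quat :: real_inner
begin

definition inner_quat_def:
  "inner x y = qRe x * qRe y + qI x * qI y + qJ x * qJ y + qK x * qK y"

definition norm_quat_def:
  "norm x = sqrt ((qRe x)\<^sup>2 + (qI x)\<^sup>2 + (qJ x)\<^sup>2 + (qK x)\<^sup>2)"

definition sgn_quat_def: "sgn (x::quat) = x /\<^sub>R norm x"

definition dist_quat_def: "dist (x::quat) y = norm (x - y)"

definition uniformity_quat_def [code del]:
  "(uniformity :: (quat \<times> quat) filter) = (INF e\<in>{0 <..}. principal {(x, y). dist x y < e})"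

definition open_quat_def [code del]:
  "open (U :: quat set) \<longleftrightarrow> (\<forall>x\<in>U. eventually (\<lambda>(x', y). x' = x \<longrightarrow> y \<in> U) uniformity)"

instance
proof
  fix x y z :: quat and r :: real and U :: "quat set"
  show "inner x y = inner y x"
    by (simp add: inner_quat_def mult.commute)
  show "inner (x + y) z = inner x z + inner y z"
    by (simp add: inner_quat_def algebra_simps)
  show "inner (scaleR r x) y = r * inner x y"
    by (simp add: inner_quat_def algebra_simps)
  show "0 \<le> inner x x"
    by (simp add: inner_quat_def)
  show "inner x x = 0 \<longleftrightarrow> x = 0"
    by (auto simp add: inner_quat_def add_nonneg_eq_0_iff quat_eq_iff)
  show "norm x = sqrt (inner x x)"
    by (simp add: inner_quat_def norm_quat_def power2_eq_square)
qed (rule sgn_quat_def dist_quat_def open_quat_def uniformity_quat_def)+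

end

instantiation quat :: real_normed_div_algebra
begin

primcorec inverse_quat where
  "qRe (inverse x) = qRe x / ((qRe x)\<^sup>2 + (qI x)\<^sup>2 + (qJ x)\<^sup>2 + (qK x)\<^sup>2)"
| "qI (inverse x) = - qI x / ((qRe x)\<^sup>2 + (qI x)\<^sup>2 + (qJ x)\<^sup>2 + (qK x)\<^sup>2)"
| "qJ (inverse x) = - qJ x / ((qRe x)\<^sup>2 + (qI x)\<^sup>2 + (qJ x)\<^sup>2 + (qK x)\<^sup>2)"
| "qK (inverse x) = - qK x / ((qRe x)\<^sup>2 + (qI x)\<^sup>2 + (qJ x)\<^sup>2 + (qK x)\<^sup>2)"

definition divide_quat_def: "(x::quat) div y = x * inverse y"

instance
proof
  fix x y :: quat
  define N where "N = (qRe x)\<^sup>2 + (qI x)\<^sup>2 + (qJ x)\<^sup>2 + (qK x)\<^sup>2"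
  have N: "N \<noteq> 0" if "x \<noteq> 0"
    using that unfolding N_def by (auto simp add: add_nonneg_eq_0_iff quat_eq_iff)
  show "inverse x * x = 1" if "x \<noteq> 0"
  proof -
    have "(qRe x * qRe x + qI x * qI x + qJ x * qJ x + qK x * qK x) / N = 1"
      using N[OF that] by (simp add: N_def power2_eq_square)
    then show ?thesis
      by (simp add: quat_eq_iff N_def[symmetric] add_divide_distrib mult.commute)
  qed
  show "x * inverse x = 1" if "x \<noteq> 0"
  proof -
    have "(qRe x * qRe x + qI x * qI x + qJ x * qJ x + qK x * qK x) / N = 1"
      using N[OF that] by (simp add: N_def power2_eq_square)
    then show ?thesis
      by (simp add: quat_eq_iff N_def[symmetric] add_divide_distrib mult.commute)
  qed
  show "inverse (0::quat) = 0"
    by (simp add: quat_eq_iff)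
  show "x div y = x * inverse y"
    by (rule divide_quat_def)
  show "norm (x * y) = norm x * norm y"
    unfolding norm_quat_def real_sqrt_mult[symmetric]
    by (rule arg_cong[where f = sqrt]) (simp add: power2_eq_square algebra_simps)
qed

end

instantiation quat :: euclidean_space
begin

definition Basis_quat_def: "Basis = {Quat 1 0 0 0, Quat 0 1 0 0, Quat 0 0 1 0, Quat 0 0 0 1}"

instance
proof
  fix u v x :: quat
  show "(Basis :: quat set) \<noteq> {}" and "finite (Basis :: quat set)"
    by (simp_all add: Basis_quat_def)
  show "inner u v = (if u = v then 1 else 0)" if "u \<in> Basis" "v \<in> Basis"
    using that unfolding Basis_quat_def by (elim insertE emptyE) (simp_all add: inner_quat_def)
  show "(\<forall>u\<in>Basis. inner x u = 0) \<longleftrightarrow> x = 0"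
    by (simp add: Basis_quat_def inner_quat_def quat_eq_iff[of x 0])
qed

end


section \<open>The scalars\<close>

text \<open>
  Conjugation and real part on \<open>\<real>\<close>, \<open>\<complex>\<close> and \<open>\<H>\<close>. The class only serves to write the definitions
  below once; it is instantiated by exactly the types \<open>real\<close>, \<open>complex\<close> and \<open>quat\<close>.
\<close>

class hilbert_scalar = real_normed_div_algebra + euclidean_space +
  fixes kconj :: "'a \<Rightarrow> 'a"
    and kre :: "'a \<Rightarrow> real"
  assumes kconj_add: "kconj (x + y) = kconj x + kconj y"
    and kconj_mult: "kconj (x * y) = kconj y * kconj x"
    and kconj_kconj: "kconj (kconj x) = x"
    and kconj_mult_self: "kconj x * x = (norm x)\<^sup>2 *\<^sub>R 1"
    and add_kconj_self: "x + kconj x = (2 * kre x) *\<^sub>R 1"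

instantiation real :: hilbert_scalar
begin

definition kconj_real_def: "kconj (x::real) = x"
definition kre_real_def: "kre (x::real) = x"

instance
  by standard (simp_all add: kconj_real_def kre_real_def power2_eq_square)

end

instantiation complex :: hilbert_scalar
begin

definition kconj_complex_def: "kconj = cnj"
definition kre_complex_def: "kre = Re"

instance
proof
  fix x :: complex
  show "kconj x * x = (norm x)\<^sup>2 *\<^sub>R 1"
    unfolding of_real_def[symmetric]
    by (simp only: kconj_complex_def complex_norm_square mult.commute)
qed (simp_all add: kconj_complex_def kre_complex_def complex_eq_iff)

end

instantiation quat :: hilbert_scalar
begin

primcorec kconj_quat where
  "qRe (kconj x) = qRe x"
| "qI (kconj x) = - qI x"
| "qJ (kconj x) = - qJ x"
| "qK (kconj x) = - qK x"

definition kre_quat_def: "kre = qRe"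

instance
  by standard
    (simp_all add: quat_eq_iff kre_quat_def norm_quat_def power2_eq_square algebra_simps)

end


section \<open>Right Hilbert spaces\<close>

text \<open>
  The type class \<open>banach\<close> supplies addition, the real scalar multiplication, the norm and
  completeness; \<open>ract x a\<close> is the right action \<open>x a\<close>, which has to extend the real one, and
  \<open>form\<close> is the Hermitian form, which has to induce the norm.
\<close>

locale right_hilbert_space =
  fixes ract :: "'h::banach \<Rightarrow> 'k::hilbert_scalar \<Rightarrow> 'h"
    and form :: "'h \<Rightarrow> 'h \<Rightarrow> 'k"
  assumes ract_add_left: "ract (x + y) a = ract x a + ract y a"
    and ract_add_right: "ract x (a + b) = ract x a + ract x b"
    and ract_ract: "ract (ract x a) b = ract x (a * b)"
    and ract_of_real: "ract x (of_real r) = r *\<^sub>R x"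
    and form_linear: "form x (ract y a + z) = form x y * a + form x z"
    and form_kconj: "form x y = kconj (form y x)"
    and form_self: "form x x = of_real ((norm x)\<^sup>2)"

definition subspaceK :: "('h::banach \<Rightarrow> 'k::hilbert_scalar \<Rightarrow> 'h) \<Rightarrow> 'h set \<Rightarrow> bool" where
  "subspaceK ract E \<longleftrightarrow>
     0 \<in> E \<and> (\<forall>x\<in>E. \<forall>y\<in>E. x + y \<in> E) \<and> (\<forall>x\<in>E. \<forall>a. ract x a \<in> E)"

definition basisK ::
  "('h::banach \<Rightarrow> 'k::hilbert_scalar \<Rightarrow> 'h) \<Rightarrow> 'h set \<Rightarrow> nat \<Rightarrow> (nat \<Rightarrow> 'h) \<Rightarrow> bool" where
  "basisK ract E n b \<longleftrightarrow>
     (\<forall>i<n. b i \<in> E) \<and>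
     (\<forall>x\<in>E. \<exists>a. x = (\<Sum>i<n. ract (b i) (a i))) \<and>
     (\<forall>a. (\<Sum>i<n. ract (b i) (a i)) = 0 \<longrightarrow> (\<forall>i<n. a i = 0))"

definition has_dimK ::
  "('h::banach \<Rightarrow> 'k::hilbert_scalar \<Rightarrow> 'h) \<Rightarrow> 'h set \<Rightarrow> nat \<Rightarrow> bool" where
  "has_dimK ract E n \<longleftrightarrow> subspaceK ract E \<and> (\<exists>b. basisK ract E n b)"

locale separable_inf_dim_right_hilbert_space = right_hilbert_space ract form
  for ract :: "'h::banach \<Rightarrow> 'k::hilbert_scalar \<Rightarrow> 'h" and form :: "'h \<Rightarrow> 'h \<Rightarrow> 'k" +
  assumes separable: "\<exists>D::'h set. countable D \<and> closure D = UNIV"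
    and infinite_dimensional: "\<nexists>n. has_dimK ract UNIV n"

definition bounded_linearK ::
  "('h::banach \<Rightarrow> 'k::hilbert_scalar \<Rightarrow> 'h) \<Rightarrow> ('h \<Rightarrow> 'h) \<Rightarrow> bool" where
  "bounded_linearK ract g \<longleftrightarrow>
     bounded_linear g \<and> (\<forall>x a. g (ract x a) = ract (g x) a)"

definition is_adjoint ::
  "('h::banach \<Rightarrow> 'h \<Rightarrow> 'k::hilbert_scalar) \<Rightarrow> ('h \<Rightarrow> 'h) \<Rightarrow> ('h \<Rightarrow> 'h) \<Rightarrow> bool" where
  "is_adjoint form g gs \<longleftrightarrow> (\<forall>x y. form (gs x) y = form x (g y))"

lemma (in right_hilbert_space) is_adjoint_unique:
  assumes "is_adjoint form g h" "is_adjoint form g h'"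
  shows "h = h'"
proof
  fix x
  have diff: "form y (u - v) = form y u - form y v" for y u v
    using form_linear[of y v "of_real (- 1)" u] unfolding ract_of_real by simp
  have "form (h x) y = form (h' x) y" for y
    using assms by (simp add: is_adjoint_def)
  then have "form y (h x) = form y (h' x)" for y
    using form_kconj[of y "h x"] form_kconj[of y "h' x"] by simp
  then have "form (h x - h' x) (h x - h' x) = 0"
    by (simp add: diff)
  then show "h x = h' x"
    by (simp add: form_self)
qed


section \<open>The form of signature \<open>(p, \<infinity>)\<close>\<close>

definition orth_compl :: "('h::banach \<Rightarrow> 'h \<Rightarrow> 'k::hilbert_scalar) \<Rightarrow> 'h set \<Rightarrow> 'h set" where
  "orth_compl form E = {y. \<forall>x\<in>E. form x y = 0}"

text \<open>The decomposition \<open>x = u + v\<close> exists and is unique when \<open>E0\<close> is finite-dimensional.\<close>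

definition Phi :: "('h::banach \<Rightarrow> 'h \<Rightarrow> 'k::hilbert_scalar) \<Rightarrow> 'h set \<Rightarrow> 'h \<Rightarrow> 'h" where
  "Phi form E0 x = (THE z. \<exists>u\<in>E0. \<exists>v\<in>orth_compl form E0. x = u + v \<and> z = u - v)"

definition Bform :: "('h::banach \<Rightarrow> 'h \<Rightarrow> 'k::hilbert_scalar) \<Rightarrow> 'h set \<Rightarrow> 'h \<Rightarrow> 'h \<Rightarrow> 'k" where
  "Bform form E0 x y = form x (Phi form E0 y)"

definition Qform :: "('h::banach \<Rightarrow> 'h \<Rightarrow> 'k::hilbert_scalar) \<Rightarrow> 'h set \<Rightarrow> 'h \<Rightarrow> 'k" where
  "Qform form E0 x = Bform form E0 x x"

text \<open>
  \<open>Qform\<close> is \<open>'k\<close>-valued; since \<open>Phi\<close> is self-adjoint its values are real, and positivity is stated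
  as being (the image in \<open>'k\<close> of) a positive real.
\<close>

definition Xp ::
  "('h::banach \<Rightarrow> 'k::hilbert_scalar \<Rightarrow> 'h) \<Rightarrow> ('h \<Rightarrow> 'h \<Rightarrow> 'k) \<Rightarrow> 'h set \<Rightarrow> nat \<Rightarrow> 'h set set" where
  "Xp ract form E0 p =
     {E. has_dimK ract E p \<and> (\<forall>x\<in>E. x \<noteq> 0 \<longrightarrow> (\<exists>r>0. Qform form E0 x = of_real r))}"

text \<open>
  An adjoint of \<open>g\<close> is unique (\<open>is_adjoint_unique\<close>), so \<open>gs\<close> below is \<open>g\<^sup>*\<close>.
\<close>

definition Op_inf ::
  "('h::banach \<Rightarrow> 'k::hilbert_scalar \<Rightarrow> 'h) \<Rightarrow> ('h \<Rightarrow> 'h \<Rightarrow> 'k) \<Rightarrow> 'h set \<Rightarrow> ('h \<Rightarrow> 'h) set" where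
  "Op_inf ract form E0 =
     {g. bounded_linearK ract g \<and>
         (\<exists>h. bounded_linearK ract h \<and> g \<circ> h = id \<and> h \<circ> g = id) \<and>
         (\<exists>gs. is_adjoint form g gs \<and> gs \<circ> Phi form E0 \<circ> g = Phi form E0)}"


section \<open>Hyperbolic principal angles\<close>

definition B_orth ::
  "('h::banach \<Rightarrow> 'h \<Rightarrow> 'k::hilbert_scalar) \<Rightarrow> 'h set \<Rightarrow> 'h set \<Rightarrow> 'h set \<Rightarrow> 'h set" where
  "B_orth form E0 S E = {e\<in>E. \<forall>x\<in>S. Bform form E0 x e = 0}"

text \<open>
  The inductive procedure with its choices \<open>x\<close>, \<open>y\<close>, indexed from \<open>0\<close>: the vectors
  \<open>x\<^sub>1, \<dots>, x\<^sub>p\<close> are \<open>x 0, \<dots>, x (p - 1)\<close>, and likewise for \<open>y\<close> and \<open>c\<close>.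
\<close>

definition principal_run ::
  "('h::banach \<Rightarrow> 'h \<Rightarrow> 'k::hilbert_scalar) \<Rightarrow> 'h set \<Rightarrow> nat \<Rightarrow> 'h set \<Rightarrow> 'h set \<Rightarrow>
    (nat \<Rightarrow> 'h) \<Rightarrow> (nat \<Rightarrow> 'h) \<Rightarrow> (nat \<Rightarrow> real) \<Rightarrow> bool" where
  "principal_run form E0 p E F x y c \<longleftrightarrow>
     (\<forall>l<p. let El = B_orth form E0 (x ` {..<l}) E; Fl = B_orth form E0 (y ` {..<l}) F in
        c l = Sup {kre (Bform form E0 u v) | u v.
                     u \<in> El \<and> v \<in> Fl \<and> Qform form E0 u = 1 \<and> Qform form E0 v = 1} \<and>
        x l \<in> El \<and> y l \<in> Fl \<and> Qform form E0 (x l) = 1 \<and> Qform form E0 (y l) = 1 \<and>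
        Bform form E0 (x l) (y l) = of_real (c l))"

text \<open>
  The family is a function of \<open>E\<close> and \<open>F\<close> because the numbers \<open>c l\<close> do not depend on the choices.
\<close>

definition hyp_principal_angles ::
  "('h::banach \<Rightarrow> 'h \<Rightarrow> 'k::hilbert_scalar) \<Rightarrow> 'h set \<Rightarrow> nat \<Rightarrow> 'h set \<Rightarrow> 'h set \<Rightarrow> real list" where
  "hyp_principal_angles form E0 p E F =
     (THE \<alpha>s. \<exists>x y c. principal_run form E0 p E F x y c \<and>
                       \<alpha>s = map (\<lambda>l. arcosh (c l)) [0..<p])"

end

theory Submission
  imports Defs
begin

text \<open>
  The vectors \<open>x i\<close>, \<open>y i\<close> of a run are orthonormal bases of \<open>E\<close> and \<open>F\<close>, and maximality of
  \<open>c i\<close> forces \<open>x i\<close> and \<open>y j\<close> to be orthogonal for \<open>i \<noteq> j\<close>. Hence the nonzero ones among the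
  vectors \<open>x i\<close> and \<open>y i - x i c i\<close> form an orthogonal basis of \<open>E + F\<close> whose Gram matrix, with
  entries \<open>1\<close> and \<open>1 - (c i)\<^sup>2\<close>, depends only on the angles. Two pairs with the same angles are
  therefore related by Witt's theorem, whose isometry can be taken to be a product of
  quasi-reflections \<open>v \<mapsto> v + z l \<B>(z, v)\<close>. These are perturbations of the identity of finite rank,
  so boundedness and invertibility are automatic and no Hilbert basis of \<open>E\<^sup>\<bottom>\<close> is needed.
\<close>

section \<open>Scalars\<close>

text \<open>A residual \<open>y i - x i c i\<close> whose square is \<open>0\<close> must itself be
  \<open>0\<close>, since the Gram matrix cannot tell a nonzero isotropic vector from the zero
  vector. This holds because the orthogonal of a \<open>p\<close>-dimensional positive subspace is
  negative definite; the same fact gives \<open>c i \<ge> 1\<close>, the range on which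
  \<open>arcosh\<close> is injective. The \<open>THE\<close> defining the angles needs a run to
  exist, which comes from compactness of unit spheres, and its numbers to be independent of the
  choices, which comes from a min-max comparison of two runs. As the scalars may be quaternions,
  determinants are avoided: every dimension count is the solvability of a homogeneous system, and
  factors keep their order except that reals are central.\<close>

lemma kconj_mult_self_of_real: "kconj x * x = of_real ((norm x)\<^sup>2)"
  by (simp add: of_real_def kconj_mult_self)

lemma kconj_zero [simp]: "kconj (0 :: 'k::hilbert_scalar) = 0"
  using kconj_add[of "0::'k" 0] by simp

lemma kconj_minus: "kconj (- x) = - kconj (x :: 'k::hilbert_scalar)"
  using kconj_add[of "- x" x] by (simp add: eq_neg_iff_add_eq_0)

text \<open>The class does not state that conjugation fixes the reals. For real \<open>r\<close> the
  axiom on \<open>kconj x * x\<close> gives \<open>kconj r * r = r * r\<close>, and \<open>r\<close>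
  cancels.\<close>

lemma kconj_of_real [simp]: "kconj (of_real r :: 'k::hilbert_scalar) = of_real r"
proof (cases "r = 0")
  case False
  have "kconj (of_real r :: 'k) * of_real r = of_real r * of_real r"
    by (simp add: kconj_mult_self_of_real power2_eq_square flip: of_real_mult)
  with False show ?thesis by (metis mult_right_cancel of_real_eq_0_iff)
qed simp

lemma kconj_one [simp]: "kconj (1 :: 'k::hilbert_scalar) = 1"
  using kconj_of_real[of 1] by simp

lemma norm_kconj [simp]: "norm (kconj x :: 'k::hilbert_scalar) = norm x"
proof (cases "x = 0")
  case False
  have "norm (kconj x) * norm x = norm x * norm x"
    unfolding norm_mult[symmetric] kconj_mult_self_of_real
    by (simp add: norm_mult power2_eq_square norm_power)
  with False show ?thesis by simp
qed simp

lemma mult_kconj_self: "x * kconj x = of_real ((norm (x :: 'k::hilbert_scalar))\<^sup>2)"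
  using kconj_mult_self_of_real[of "kconj x"] by (simp add: kconj_kconj)

lemma kconj_inverse: "kconj (inverse x) = inverse (kconj (x :: 'k::hilbert_scalar))"
proof (cases "x = 0")
  case False
  then have "kconj x * kconj (inverse x) = 1"
    by (simp flip: kconj_mult)
  then show ?thesis by (rule inverse_unique[symmetric])
qed simp

lemma add_kconj_of_real: "x + kconj x = of_real (2 * kre (x :: 'k::hilbert_scalar))"
  by (simp add: add_kconj_self of_real_def)

lemma kre_of_real [simp]: "kre (of_real r :: 'k::hilbert_scalar) = r"
proof -
  have "of_real (2 * kre (of_real r :: 'k)) = (of_real (2 * r) :: 'k)"
    unfolding add_kconj_of_real[symmetric] by (simp only: kconj_of_real mult_2 of_real_add)
  then have "2 * kre (of_real r :: 'k) = 2 * r" by (simp only: of_real_eq_iff)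
  then show ?thesis by simp
qed

lemma kre_zero [simp]: "kre (0 :: 'k::hilbert_scalar) = 0"
  using kre_of_real[of 0] by simp

lemma kre_one [simp]: "kre (1 :: 'k::hilbert_scalar) = 1"
  using kre_of_real[of 1] by simp

lemma kre_add: "kre (x + y) = kre x + kre (y :: 'k::hilbert_scalar)"
proof -
  have "of_real (2 * kre (x + y)) = (of_real (2 * (kre x + kre y)) :: 'k)"
    unfolding add_kconj_of_real[symmetric] distrib_left of_real_add kconj_add by simp
  then show ?thesis by (simp del: of_real_mult of_real_add)
qed

lemma kre_minus: "kre (- x) = - kre (x :: 'k::hilbert_scalar)"
  using kre_add[of x "- x"] by simp

lemma kre_kconj [simp]: "kre (kconj (a :: 'k::hilbert_scalar)) = kre a"
proof -
  have "of_real (2 * kre (kconj a)) = (of_real (2 * kre a) :: 'k)"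
    unfolding add_kconj_of_real[symmetric] by (simp add: kconj_kconj add.commute)
  then have "2 * kre (kconj a) = 2 * kre a" by (simp only: of_real_eq_iff)
  then show ?thesis by simp
qed

lemma kre_le_norm: "kre (x :: 'k::hilbert_scalar) \<le> norm x"
proof -
  have "2 * kre x \<le> norm (of_real (2 * kre x) :: 'k)"
    by (simp only: norm_of_real)
  also have "\<dots> \<le> norm x + norm (kconj x)"
    unfolding add_kconj_of_real[symmetric] by (rule norm_triangle_ineq)
  finally show ?thesis by simp
qed

lemma kconj_eq_self_imp_real:
  assumes "kconj x = (x :: 'k::hilbert_scalar)"
  shows "x = of_real (kre x)"
proof -
  have "2 *\<^sub>R x = 2 *\<^sub>R of_real (kre x)"
    using add_kconj_self[of x] assms by (simp add: of_real_def scaleR_2[symmetric])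
  then show ?thesis by simp
qed


section \<open>Homogeneous linear systems over a division ring\<close>

text \<open>Gaussian elimination, by induction on the equations. Coefficients stand to the left of
  the unknowns, which fits coordinates in a right vector space.\<close>

lemma homogeneous_system_solution:
  fixes A :: "'i \<Rightarrow> 'j \<Rightarrow> 'k::division_ring"
  assumes "finite I" "finite J" "card I < card J"
  shows "\<exists>a. (\<exists>j\<in>J. a j \<noteq> 0) \<and> (\<forall>i\<in>I. (\<Sum>j\<in>J. A i j * a j) = 0)"
  using assms
proof (induction I arbitrary: J A rule: finite_induct)
  case empty
  then have "J \<noteq> {}" by auto
  then show ?case by (intro exI[of _ "\<lambda>_. 1"]) auto
next
  case (insert k I)
  show ?case
  proof (cases "\<forall>j\<in>J. A k j = 0")
    case True
    from insert have "card I < card J" by simp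
    with insert.IH[of J A] insert.prems True show ?thesis by fastforce
  next
    case False
    then obtain l where l: "l \<in> J" "A k l \<noteq> 0" by blast
    \<comment> \<open>Coefficients left after the pivot equation \<open>k\<close> has been solved
      for the unknown \<open>l\<close> and substituted.\<close>
    define C where "C i j = A i j - A i l * (inverse (A k l) * A k j)" for i j
    have "card I < card (J - {l})" using insert l by simp
    with insert.IH[of "J - {l}" C] insert.prems obtain a j0 where
      a: "j0 \<in> J - {l}" "a j0 \<noteq> 0" "\<And>i. i \<in> I \<Longrightarrow> (\<Sum>j\<in>J - {l}. C i j * a j) = 0"
      by auto
    define s where "s i = (\<Sum>j\<in>J - {l}. A i j * a j)" for i
    \<comment> \<open>Back substitution: the value at \<open>l\<close> is the one that the pivot
      equation prescribes.\<close>
    define a' where "a' = a(l := - (inverse (A k l) * s k))"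
    have split: "(\<Sum>j\<in>J. A i j * a' j) = s i - A i l * (inverse (A k l) * s k)" for i
    proof -
      have "(\<Sum>j\<in>J. A i j * a' j) = A i l * a' l + (\<Sum>j\<in>J - {l}. A i j * a' j)"
        using insert.prems l by (intro sum.remove) auto
      also have "(\<Sum>j\<in>J - {l}. A i j * a' j) = s i"
        unfolding s_def by (intro sum.cong) (auto simp: a'_def)
      finally show ?thesis by (simp add: a'_def)
    qed
    have "s i - A i l * (inverse (A k l) * s k) = 0" if "i \<in> I" for i
      using a(3)[OF that]
      by (simp add: C_def s_def left_diff_distrib sum_subtractf sum_distrib_left mult.assoc)
    moreover have "s k - A k l * (inverse (A k l) * s k) = 0"
      using l by (simp flip: mult.assoc)
    ultimately have "\<forall>i\<in>insert k I. (\<Sum>j\<in>J. A i j * a' j) = 0"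
      by (simp add: split)
    moreover have "j0 \<in> J" "a' j0 \<noteq> 0" using a by (auto simp: a'_def)
    ultimately show ?thesis by blast
  qed
qed


section \<open>Hermitian forms\<close>

text \<open>No definiteness is assumed, so that the results serve both the Hilbert form and the
  indefinite form \<B>. Boundedness of the two bilinear maps makes the continuity and summation
  rules of \<open>bounded_bilinear\<close> available.\<close>

locale hermitian_space =
  fixes ract :: "'h::banach \<Rightarrow> 'k::hilbert_scalar \<Rightarrow> 'h" and B :: "'h \<Rightarrow> 'h \<Rightarrow> 'k"
  assumes ract_bilinear: "bounded_bilinear ract"
    and ract_mult: "ract (ract x a) b = ract x (a * b)"
    and ract_real: "ract x (of_real r) = r *\<^sub>R x"
    and B_bilinear: "bounded_bilinear B"
    and B_ract_right: "B x (ract y a) = B x y * a"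
    and B_kconj: "B x y = kconj (B y x)"
begin

sublocale ract: bounded_bilinear ract by (rule ract_bilinear)
sublocale B: bounded_bilinear B by (rule B_bilinear)

lemma B_ract_left: "B (ract x a) y = kconj a * B x y"
  by (subst (1 2) B_kconj) (simp add: B_ract_right kconj_mult)

lemma B_self: "B x x = of_real (kre (B x x))"
  using B_kconj[of x x] by (intro kconj_eq_self_imp_real) simp

lemma B_eq_zero_commute: "B x y = 0 \<longleftrightarrow> B y x = 0"
  using B_kconj[of x y] B_kconj[of y x] by auto

lemma B_self_ract: "B (ract x a) (ract x a) = of_real ((norm a)\<^sup>2 * kre (B x x))"
proof -
  have "B (ract x a) (ract x a) = kconj a * (of_real (kre (B x x)) * a)"
    by (simp only: B_ract_left B_ract_right B_self[symmetric] mult.assoc)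
  also have "\<dots> = of_real (kre (B x x)) * (kconj a * a)"
    by (simp add: of_real_def)
  finally show ?thesis by (simp add: kconj_mult_self_of_real mult.commute flip: of_real_mult of_real_power)
qed

lemma ract_one [simp]: "ract x 1 = x"
  using ract_real[of x 1] by simp

lemma ract_eq_0_iff: "ract x a = 0 \<longleftrightarrow> x = 0 \<or> a = 0"
proof
  assume "ract x a = 0"
  then have "ract x (a * inverse a) = 0"
    by (simp add: ract.zero_left flip: ract_mult)
  then show "x = 0 \<or> a = 0" by (cases "a = 0") auto
qed (auto simp: ract.zero_left ract.zero_right)

lemma subspaceK_diff:
  assumes "subspaceK ract E" "x \<in> E" "y \<in> E"
  shows "x - y \<in> E"
proof -
  have "ract y (of_real (- 1)) \<in> E" using assms unfolding subspaceK_def by blast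
  then have "x + (- 1) *\<^sub>R y \<in> E" using assms unfolding ract_real subspaceK_def by blast
  then show ?thesis by simp
qed

lemma subspaceK_scaleR:
  assumes "subspaceK ract E" "x \<in> E"
  shows "r *\<^sub>R x \<in> E"
  using assms unfolding ract_real[symmetric] subspaceK_def by blast

lemma subspaceK_sum:
  assumes "subspaceK ract E" "\<And>i. i \<in> I \<Longrightarrow> f i \<in> E"
  shows "(\<Sum>i\<in>I. f i) \<in> E"
  using assms(2)
  by (induction I rule: infinite_finite_induct) (use assms(1) in \<open>auto simp: subspaceK_def\<close>)

lemma subspaceK_comb:
  assumes "subspaceK ract E" "\<And>i. i \<in> I \<Longrightarrow> b i \<in> E"
  shows "(\<Sum>i\<in>I. ract (b i) (a i)) \<in> E"
  using assms by (intro subspaceK_sum) (auto simp: subspaceK_def)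

lemma B_comb_right: "B x (\<Sum>i\<in>I. ract (b i) (a i)) = (\<Sum>i\<in>I. B x (b i) * a i)"
  by (simp add: B.sum_right B_ract_right)

lemma B_comb_left: "B (\<Sum>i\<in>I. ract (b i) (a i)) x = (\<Sum>i\<in>I. kconj (a i) * B (b i) x)"
  by (simp add: B.sum_left B_ract_left)

lemma B_comb_biorthogonal:
  assumes "finite I" "\<And>i j. i \<in> I \<Longrightarrow> j \<in> I \<Longrightarrow> i \<noteq> j \<Longrightarrow> B (b i) (d j) = 0"
  shows "B (\<Sum>i\<in>I. ract (b i) (a i)) (\<Sum>i\<in>I. ract (d i) (e i)) =
    (\<Sum>i\<in>I. kconj (a i) * B (b i) (d i) * e i)"
proof -
  have "B (b i) (\<Sum>i\<in>I. ract (d i) (e i)) = B (b i) (d i) * e i" if "i \<in> I" for i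
  proof -
    have "(\<Sum>j\<in>I - {i}. B (b i) (d j) * e j) = 0"
      using assms(2)[OF that] by (intro sum.neutral) auto
    then show ?thesis
      unfolding B_comb_right by (subst sum.remove[OF assms(1) that]) simp
  qed
  then show ?thesis by (simp add: B_comb_left mult.assoc)
qed

lemma B_self_comb_orthogonal:
  assumes "finite I" "\<And>i j. i \<in> I \<Longrightarrow> j \<in> I \<Longrightarrow> i \<noteq> j \<Longrightarrow> B (b i) (b j) = 0"
  shows "B (\<Sum>i\<in>I. ract (b i) (a i)) (\<Sum>i\<in>I. ract (b i) (a i)) =
    of_real (\<Sum>i\<in>I. (norm (a i))\<^sup>2 * kre (B (b i) (b i)))"
proof -
  have "kconj (a i) * B (b i) (b i) * a i = of_real ((norm (a i))\<^sup>2 * kre (B (b i) (b i)))" for i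
    using B_self_ract[of "b i" "a i"] by (simp add: B_ract_left B_ract_right mult.assoc)
  with assms show ?thesis by (simp add: B_comb_biorthogonal)
qed

section \<open>Orthonormal systems in positive subspaces\<close>

definition orthonormal :: "nat \<Rightarrow> (nat \<Rightarrow> 'h) \<Rightarrow> bool" where
  "orthonormal n b \<longleftrightarrow> (\<forall>i<n. \<forall>j<n. B (b i) (b j) = (if i = j then 1 else 0))"

definition positive_on :: "'h set \<Rightarrow> bool" where
  "positive_on E \<longleftrightarrow> (\<forall>x\<in>E. x \<noteq> 0 \<longrightarrow> kre (B x x) > 0)"

lemma orthonormal_coeff:
  assumes "orthonormal n b" "j < n"
  shows "B (b j) (\<Sum>i<n. ract (b i) (a i)) = a j"
proof -
  have "B (b j) (\<Sum>i<n. ract (b i) (a i)) = (\<Sum>i<n. if j = i then a i else 0)"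
    unfolding B_comb_right using assms
    by (intro sum.cong) (auto simp: orthonormal_def)
  with assms show ?thesis by simp
qed

lemma orthonormal_B_self_comb:
  assumes "orthonormal n b" "I \<subseteq> {..<n}"
  shows "B (\<Sum>i\<in>I. ract (b i) (a i)) (\<Sum>i\<in>I. ract (b i) (a i)) = of_real (\<Sum>i\<in>I. (norm (a i))\<^sup>2)"
proof -
  have fin: "finite I" using assms(2) finite_subset by blast
  have "B (b i) (b j) = 0" if "i \<in> I" "j \<in> I" "i \<noteq> j" for i j
    using that assms by (auto simp: orthonormal_def subset_iff)
  then have "B (\<Sum>i\<in>I. ract (b i) (a i)) (\<Sum>i\<in>I. ract (b i) (a i)) =
      of_real (\<Sum>i\<in>I. (norm (a i))\<^sup>2 * kre (B (b i) (b i)))"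
    by (intro B_self_comb_orthogonal fin)
  also have "(\<Sum>i\<in>I. (norm (a i))\<^sup>2 * kre (B (b i) (b i))) = (\<Sum>i\<in>I. (norm (a i))\<^sup>2)"
    using assms by (intro sum.cong) (auto simp: orthonormal_def)
  finally show ?thesis .
qed

lemma exists_orthogonal_vector:
  assumes "has_dimK ract E n" "l < n"
  shows "\<exists>u\<in>E. u \<noteq> 0 \<and> (\<forall>i<l. B (x i) u = 0)"
proof -
  obtain b where E: "subspaceK ract E" and b: "basisK ract E n b"
    using assms by (auto simp: has_dimK_def)
  obtain a j where a: "j < n" "a j \<noteq> 0" "\<forall>i<l. (\<Sum>j<n. B (x i) (b j) * a j) = 0"
    using homogeneous_system_solution[of "{..<l}" "{..<n}" "\<lambda>i j. B (x i) (b j)"] assms by auto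
  define u where "u = (\<Sum>j<n. ract (b j) (a j))"
  have "u \<in> E" unfolding u_def using b by (intro subspaceK_comb E) (auto simp: basisK_def)
  moreover have "u \<noteq> 0" using b a(1,2) unfolding u_def basisK_def by blast
  moreover have "\<forall>i<l. B (x i) u = 0" using a(3) by (simp add: u_def B_comb_right)
  ultimately show ?thesis by blast
qed

text \<open>Expanding the \<open>n + 1\<close> vectors in a basis leaves \<open>n\<close> equations
  for \<open>n + 1\<close> coefficients.\<close>

lemma exists_dependence:
  assumes "has_dimK ract E n" "\<And>i. i \<le> n \<Longrightarrow> v i \<in> E"
  shows "\<exists>a. (\<exists>j\<le>n. a j \<noteq> 0) \<and> (\<Sum>j\<le>n. ract (v j) (a j)) = 0"
proof -
  obtain b where b: "basisK ract E n b" using assms by (auto simp: has_dimK_def)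
  have "\<forall>j. \<exists>A. j \<le> n \<longrightarrow> v j = (\<Sum>i<n. ract (b i) (A i))"
    using b assms(2) unfolding basisK_def by blast
  then obtain A where A: "\<And>j. j \<le> n \<Longrightarrow> v j = (\<Sum>i<n. ract (b i) (A j i))" by metis
  obtain a where a: "\<exists>j\<le>n. a j \<noteq> 0" "\<forall>i<n. (\<Sum>j\<le>n. A j i * a j) = 0"
    using homogeneous_system_solution[of "{..<n}" "{..n}" "\<lambda>i j. A j i"] by auto
  have "(\<Sum>j\<le>n. ract (v j) (a j)) = (\<Sum>j\<le>n. \<Sum>i<n. ract (b i) (A j i * a j))"
    by (intro sum.cong) (auto simp: A ract.sum_left ract_mult)
  also have "\<dots> = (\<Sum>i<n. ract (b i) (\<Sum>j\<le>n. A j i * a j))"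
    by (subst sum.swap) (simp add: ract.sum_right)
  also have "\<dots> = 0" using a(2) by (simp add: ract.zero_right)
  finally show ?thesis using a(1) by blast
qed

lemma exists_normalised:
  assumes "kre (B u u) > 0"
  shows "\<exists>r. r > 0 \<and> B (r *\<^sub>R u) (r *\<^sub>R u) = 1"
proof -
  let ?r = "inverse (sqrt (kre (B u u)))"
  have "B (?r *\<^sub>R u) (?r *\<^sub>R u) = of_real (?r\<^sup>2 * kre (B u u))"
    unfolding ract_real[symmetric] B_self_ract norm_of_real by (simp only: power2_abs)
  also have "?r\<^sup>2 * kre (B u u) = 1"
    using assms by (simp add: power_inverse)
  finally show ?thesis using assms by (intro exI[of _ ?r]) auto
qed

lemma exists_orthonormal_extension:
  assumes E: "has_dimK ract E n" "positive_on E" and "l < n"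
  shows "\<exists>u\<in>E. B u u = 1 \<and> (\<forall>i<l. B (x i) u = 0)"
proof -
  obtain u where u: "u \<in> E" "u \<noteq> 0" "\<forall>i<l. B (x i) u = 0"
    using exists_orthogonal_vector[OF E(1) \<open>l < n\<close>] by blast
  obtain r where "B (r *\<^sub>R u) (r *\<^sub>R u) = 1"
    using exists_normalised[of u] u E(2) by (auto simp: positive_on_def)
  moreover have "r *\<^sub>R u \<in> E"
    using E(1) u(1) by (intro subspaceK_scaleR) (auto simp: has_dimK_def)
  moreover have "\<forall>i<l. B (x i) (r *\<^sub>R u) = 0"
    using u(3) by (simp add: B.scaleR_right)
  ultimately show ?thesis by blast
qed

lemma exists_orthonormal:
  assumes E: "has_dimK ract E n" "positive_on E" and "m \<le> n"
  shows "\<exists>b. orthonormal m b \<and> (\<forall>i<m. b i \<in> E)"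
  using \<open>m \<le> n\<close>
proof (induction m)
  case 0
  then show ?case by (simp add: orthonormal_def)
next
  case (Suc m)
  then obtain b where b: "orthonormal m b" "\<forall>i<m. b i \<in> E" by auto
  obtain u where u: "u \<in> E" "B u u = 1" "\<forall>i<m. B (b i) u = 0"
    using exists_orthonormal_extension[OF E, of m b] Suc.prems by auto
  have "orthonormal (Suc m) (b(m := u))"
    using b(1) u B_eq_zero_commute[of u] by (auto simp: orthonormal_def less_Suc_eq)
  moreover have "\<forall>i<Suc m. (b(m := u)) i \<in> E"
    using b u by (auto simp: less_Suc_eq)
  ultimately show ?case by blast
qed

text \<open>A nonzero remainder \<open>r\<close> would have nonzero square and be orthogonal to
  every \<open>b i\<close>. Together these are \<open>n + 1\<close> pairwise orthogonal
  non-isotropic vectors in dimension \<open>n\<close>, and pairing a dependence with one of them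
  kills its coefficient.\<close>

lemma orthonormal_expansion:
  assumes E: "has_dimK ract E n" "positive_on E"
    and b: "orthonormal n b" "\<And>i. i < n \<Longrightarrow> b i \<in> E" and "x \<in> E"
  shows "x = (\<Sum>i<n. ract (b i) (B (b i) x))"
proof (rule ccontr)
  define r where "r = x - (\<Sum>i<n. ract (b i) (B (b i) x))"
  assume "x \<noteq> (\<Sum>i<n. ract (b i) (B (b i) x))"
  then have "r \<noteq> 0" by (simp add: r_def)
  have sub: "subspaceK ract E" using E by (simp add: has_dimK_def)
  have "r \<in> E" unfolding r_def
    using b(2) \<open>x \<in> E\<close> by (intro subspaceK_diff subspaceK_comb sub) auto
  then have Br: "B r r \<noteq> 0"
    using E(2) \<open>r \<noteq> 0\<close> by (fastforce simp: positive_on_def)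
  have br: "B (b i) r = 0" if "i < n" for i
    using that by (simp add: r_def B.diff_right orthonormal_coeff[OF b(1)])
  define v where "v = b(n := r)"
  have "v i \<in> E" if "i \<le> n" for i
    using that b(2) \<open>r \<in> E\<close> by (auto simp: v_def)
  then obtain a j where a: "j \<le> n" "a j \<noteq> 0" "(\<Sum>j\<le>n. ract (v j) (a j)) = 0"
    using exists_dependence[OF E(1), of v] by blast
  have orth: "B (v j) (v i) = 0" if "i \<le> n" "i \<noteq> j" for i
    using that a(1) b(1) br B_eq_zero_commute[of r]
    by (auto simp: v_def orthonormal_def)
  have "0 = B (v j) (\<Sum>j\<le>n. ract (v j) (a j))" by (simp add: a(3) B.zero_right)
  also have "\<dots> = B (v j) (v j) * a j"
    unfolding B_comb_right using a(1) orth by (subst sum.remove[of _ j]) auto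
  finally have "B (v j) (v j) = 0" using a(2) by simp
  moreover have "B (v j) (v j) \<noteq> 0"
    using a(1) b(1) Br by (cases "j = n") (auto simp: v_def orthonormal_def)
  ultimately show False by simp
qed

section \<open>Compactness of unit spheres\<close>

lemma compact_coefficient_box:
  fixes n :: nat
  shows "compact {\<Sum>i<n. ract (b i) (a i) | a. \<forall>i. norm (a i) \<le> 1}"
proof (induction n)
  case 0
  have "{\<Sum>i<0. ract (b i) (a i) | a. \<forall>i. norm (a i) \<le> 1} = {0}"
    by (auto intro!: exI[of _ "\<lambda>_. 0"])
  then show ?case by simp
next
  case (Suc n)
  let ?K = "\<lambda>n. {\<Sum>i<n. ract (b i) (a i) | a. \<forall>i. norm (a i) \<le> 1}"
  have "?K (Suc n) = (\<lambda>(x, c). x + ract (b n) c) ` (?K n \<times> cball 0 1)"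
  proof (intro equalityI subsetI)
    fix z assume "z \<in> (\<lambda>(x, c). x + ract (b n) c) ` (?K n \<times> cball 0 1)"
    then obtain a c where "z = (\<Sum>i<n. ract (b i) (a i)) + ract (b n) c"
      "\<forall>i. norm (a i) \<le> 1" "norm c \<le> 1" by auto
    \<comment> \<open>The bound in the box ranges over all indices, not just those below
      \<open>n\<close>, so the updated \<open>a\<close> meets it at once.\<close>
    then have "z = (\<Sum>i<Suc n. ract (b i) ((a(n := c)) i))" "\<forall>i. norm ((a(n := c)) i) \<le> 1"
      by simp_all
    then show "z \<in> ?K (Suc n)" by blast
  next
    fix z assume "z \<in> ?K (Suc n)"
    then obtain a where "z = (\<Sum>i<n. ract (b i) (a i)) + ract (b n) (a n)" "\<forall>i. norm (a i) \<le> 1"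
      by auto
    moreover from this have "(\<Sum>i<n. ract (b i) (a i), a n) \<in> ?K n \<times> cball 0 1"
      by auto
    ultimately show "z \<in> (\<lambda>(x, c). x + ract (b n) c) ` (?K n \<times> cball 0 1)"
      by (intro image_eqI[of _ _ "(\<Sum>i<n. ract (b i) (a i), a n)"]) simp_all
  qed
  also have "compact \<dots>"
    by (intro compact_continuous_image compact_Times Suc.IH compact_cball)
      (auto simp: case_prod_beta intro!: continuous_intros ract.continuous_on)
  finally show ?case .
qed

text \<open>In an orthonormal basis the squared norms of the coefficients of a unit vector add up to
  \<open>1\<close>, which puts the sphere inside the compact coefficient box as the trace of a
  closed set.\<close>

lemma compact_unit_sphere:
  assumes E: "has_dimK ract E n" "positive_on E"
  shows "compact {x \<in> E. B x x = 1}"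
proof -
  obtain b where b: "orthonormal n b" "\<And>i. i < n \<Longrightarrow> b i \<in> E"
    using exists_orthonormal[OF E] by blast
  let ?K = "{\<Sum>i<n. ract (b i) (a i) | a. \<forall>i. norm (a i) \<le> 1}"
  let ?C = "{x. x = (\<Sum>i<n. ract (b i) (B (b i) x)) \<and> B x x = 1}"
  have sub: "subspaceK ract E" using E by (simp add: has_dimK_def)
  have "{x \<in> E. B x x = 1} = ?K \<inter> ?C"
  proof (intro equalityI subsetI)
    fix x assume "x \<in> {x \<in> E. B x x = 1}"
    then have x: "x = (\<Sum>i<n. ract (b i) (B (b i) x))" "B x x = 1"
      using orthonormal_expansion[OF E b] by auto
    define a where "a i = (if i < n then B (b i) x else 0)" for i
    have xa: "x = (\<Sum>i<n. ract (b i) (a i))"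
      using x(1) by (simp add: a_def)
    have "of_real (\<Sum>i<n. (norm (a i))\<^sup>2) = (1 :: 'k)"
      using orthonormal_B_self_comb[OF b(1), of "{..<n}" a] x(2) xa by simp
    then have s: "(\<Sum>i<n. (norm (a i))\<^sup>2) = 1" by (metis of_real_eq_1_iff)
    have "norm (a i) \<le> 1" for i
    proof (cases "i < n")
      case True
      have "(norm (a i))\<^sup>2 \<le> (\<Sum>i<n. (norm (a i))\<^sup>2)"
        using True by (intro member_le_sum) auto
      then show ?thesis using s power2_le_imp_le[of "norm (a i)" 1] by simp
    qed (simp add: a_def)
    with x xa show "x \<in> ?K \<inter> ?C" by auto
  next
    fix x assume "x \<in> ?K \<inter> ?C"
    moreover from this have "x \<in> E" using b(2) by (auto intro!: subspaceK_comb[OF sub])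
    ultimately show "x \<in> {x \<in> E. B x x = 1}" by auto
  qed
  moreover have "closed ?C"
    by (intro closed_Collect_conj closed_Collect_eq continuous_intros B.continuous_on
      ract.continuous_on)
  ultimately show ?thesis
    using compact_Int_closed[OF compact_coefficient_box] by simp
qed

subsection \<open>Isometries\<close>

text \<open>The isometry group expressed by the form alone, without adjoints; for \<B> it turns out
  to be \<open>Op_inf\<close>.\<close>

definition isometries :: "('h \<Rightarrow> 'h) set" where
  "isometries =
     {g. bounded_linearK ract g \<and>
         (\<exists>h. bounded_linearK ract h \<and> g \<circ> h = id \<and> h \<circ> g = id) \<and>
         (\<forall>x y. B (g x) (g y) = B x y)}"

lemma isometries_B: "g \<in> isometries \<Longrightarrow> B (g x) (g y) = B x y"
  by (simp add: isometries_def)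

lemma isometries_linearK: "g \<in> isometries \<Longrightarrow> bounded_linearK ract g"
  by (simp add: isometries_def)

lemma bounded_linearK_comp:
  "bounded_linearK ract g \<Longrightarrow> bounded_linearK ract h \<Longrightarrow> bounded_linearK ract (g \<circ> h)"
  by (auto simp: bounded_linearK_def comp_def intro: bounded_linear_compose)

lemma id_isometry: "id \<in> isometries"
  by (auto simp: isometries_def bounded_linearK_def intro!: exI[of _ id] simp: id_def bounded_linear_ident)

lemma isometries_comp:
  assumes "g \<in> isometries" "h \<in> isometries"
  shows "g \<circ> h \<in> isometries"
proof -
  obtain g' where g': "bounded_linearK ract g'" "g \<circ> g' = id" "g' \<circ> g = id"
    using assms(1) by (auto simp: isometries_def)
  obtain h' where h': "bounded_linearK ract h'" "h \<circ> h' = id" "h' \<circ> h = id"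
    using assms(2) by (auto simp: isometries_def)
  have "g \<circ> h \<circ> (h' \<circ> g') = id" "h' \<circ> g' \<circ> (g \<circ> h) = id"
    using g' h' by (simp_all add: fun_eq_iff)
  moreover have "bounded_linearK ract (h' \<circ> g')" "bounded_linearK ract (g \<circ> h)"
    using assms g' h' by (simp_all add: bounded_linearK_comp isometries_linearK)
  ultimately show ?thesis
    unfolding isometries_def using assms isometries_B by auto
qed

lemma bounded_linearK_comb:
  assumes "bounded_linearK ract g"
  shows "g (\<Sum>i\<in>I. ract (b i) (a i)) = (\<Sum>i\<in>I. ract (g (b i)) (a i))"
  using assms by (simp add: bounded_linearK_def bounded_linear.linear linear_sum)

text \<open>With \<open>B z z \<noteq> 0\<close> and \<open>l = - 2 / B z z\<close> this is the
  usual reflection along \<open>z\<close>; with \<open>B z z = 0\<close> and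
  \<open>kconj l = - l\<close> it is a transvection. Keeping \<open>l\<close> general treats
  isotropic \<open>z\<close> on the same footing.\<close>

definition quasi_reflection :: "'h \<Rightarrow> 'k \<Rightarrow> 'h \<Rightarrow> 'h" where
  "quasi_reflection z l v = v + ract z (l * B z v)"

lemma quasi_reflection_linearK: "bounded_linearK ract (quasi_reflection z l)"
proof -
  have "bounded_linear (quasi_reflection z l)"
    unfolding quasi_reflection_def
    by (intro bounded_linear_add bounded_linear_ident
        bounded_linear_compose[OF ract.bounded_linear_right]
        bounded_linear_compose[OF bounded_linear_mult_right] B.bounded_linear_right)
  then show ?thesis
    by (auto simp: bounded_linearK_def quasi_reflection_def ract.add_left B_ract_right ract_mult
        mult.assoc)
qed

lemma quasi_reflection_comp:
  assumes "l + m + m * B z z * l = 0"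
  shows "quasi_reflection z m (quasi_reflection z l v) = v"
proof -
  have "quasi_reflection z m (quasi_reflection z l v) =
      v + ract z ((l + m + m * B z z * l) * B z v)"
    by (simp add: quasi_reflection_def B.add_right B_ract_right ract.add_right algebra_simps)
  with assms show ?thesis by (simp add: ract.zero_right)
qed

text \<open>The hypothesis is what remains when the form of two images is expanded. It also makes
  \<open>kconj l\<close> the parameter of the inverse: \<open>B z z\<close> is real, so
  \<open>l\<close> and \<open>kconj l\<close> may be exchanged in the last term.\<close>

lemma quasi_reflection_isometry:
  assumes "l + kconj l + kconj l * B z z * l = 0"
  shows "quasi_reflection z l \<in> isometries"
proof -
  have "kconj l * B z z * l = l * B z z * kconj l"
    using B_self_ract[of z l] B_self_ract[of z "kconj l"]
    by (simp add: B_ract_left B_ract_right kconj_kconj mult.assoc)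
  with assms have "quasi_reflection z l \<circ> quasi_reflection z (kconj l) = id"
    "quasi_reflection z (kconj l) \<circ> quasi_reflection z l = id"
    using quasi_reflection_comp[of l "kconj l" z] quasi_reflection_comp[of "kconj l" l z]
    by (simp_all add: fun_eq_iff add.commute)
  moreover have "B (quasi_reflection z l x) (quasi_reflection z l y) = B x y" for x y
  proof -
    have "B (quasi_reflection z l x) (quasi_reflection z l y) =
        B x y + B x z * (l + kconj l + kconj l * B z z * l) * B z y"
      using B_kconj[of x z]
      by (simp add: quasi_reflection_def B.add_left B.add_right B_ract_left B_ract_right
          kconj_mult algebra_simps)
    with assms show ?thesis by simp
  qed
  ultimately show ?thesis
    unfolding isometries_def using quasi_reflection_linearK by blast
qed

text \<open>Take \<open>z = u - v\<close>. Sending \<open>u\<close> to \<open>v\<close> forces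
  \<open>l = - 1 / B z u\<close>, and with \<open>b = B z u\<close> the isometry condition becomes
  \<open>B z z = b + kconj b\<close>, which is equivalent to \<open>B u u = B v v\<close>. Vectors
  orthogonal to \<open>u\<close> and \<open>v\<close> are orthogonal to \<open>z\<close> and stay
  fixed.\<close>

lemma exists_isometry_reflecting:
  assumes q: "B u u = B v v" and z: "B (u - v) u \<noteq> 0"
  shows "\<exists>g\<in>isometries. g u = v \<and> (\<forall>w. B u w = 0 \<and> B v w = 0 \<longrightarrow> g w = w)"
proof -
  define z b where "z = u - v" and "b = B z u"
  have "b \<noteq> 0" using z by (simp add: b_def z_def)
  then have "kconj b \<noteq> 0" by (metis norm_kconj norm_eq_zero)
  have zz: "B z z = b + kconj b"
    unfolding b_def by (subst B_kconj[of z u, symmetric] | simp add: B_kconj[of u z, symmetric])+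
      (simp add: z_def B.diff_left B.diff_right q)
  define l where "l = - inverse b"
  have kl: "kconj l = - inverse (kconj b)" by (simp add: l_def kconj_minus kconj_inverse)
  have ib: "inverse b = - l" "inverse (kconj b) = - kconj l" by (simp_all add: l_def kl[unfolded l_def])
  have "kconj l * B z z * l = inverse (kconj b) * b * inverse b + inverse (kconj b) * kconj b * inverse b"
    unfolding zz kl unfolding l_def by (simp add: algebra_simps)
  also have "\<dots> = inverse (kconj b) + inverse b"
    using \<open>b \<noteq> 0\<close> \<open>kconj b \<noteq> 0\<close> by (simp add: mult.assoc)
  finally have "l + kconj l + kconj l * B z z * l = 0"
    using ib by (simp add: algebra_simps)
  then have "quasi_reflection z l \<in> isometries" by (rule quasi_reflection_isometry)
  moreover have "quasi_reflection z l u = v"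
  proof -
    have "l * B z u = of_real (- 1)" using \<open>b \<noteq> 0\<close> by (simp add: l_def flip: b_def)
    then show ?thesis unfolding quasi_reflection_def by (simp only: ract_real) (simp add: z_def)
  qed
  moreover have "quasi_reflection z l w = w" if "B u w = 0" "B v w = 0" for w
    using that by (simp add: quasi_reflection_def z_def B.diff_left ract.zero_right)
  ultimately show ?thesis by blast
qed

text \<open>A quasi-reflection taking \<open>u\<close> to \<open>v\<close> exists unless \<open>u - v\<close> is orthogonal to \<open>u\<close>; in that case
  \<open>u\<close> is sent to \<open>- v\<close> and then to \<open>v\<close>.\<close>

lemma exists_isometry_moving:
  assumes q: "B u u = B v v" and u: "B u u \<noteq> 0"
  shows "\<exists>g\<in>isometries. g u = v \<and> (\<forall>w. B u w = 0 \<and> B v w = 0 \<longrightarrow> g w = w)"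
proof (cases "B (u - v) u = 0")
  case True
  then have vu: "B v u = B u u" by (simp add: B.diff_left)
  have double: "x + x \<noteq> 0" if "x \<noteq> 0" for x :: 'k
    using that by (simp flip: scaleR_2)
  have 1: "B u u = B (- v) (- v)" using q by (simp add: B.minus_left B.minus_right)
  \<comment> \<open>Here \<open>B v u = B u u\<close>, so the value is \<open>2 * B u u\<close>; the
    step from \<open>- v\<close> to \<open>v\<close> likewise rests on
    \<open>2 * B v v \<noteq> 0\<close>.\<close>
  have 2: "B (u - - v) u \<noteq> 0" using u vu double by (simp add: B.add_left)
  obtain g where g: "g \<in> isometries" "g u = - v" "\<And>w. B u w = 0 \<Longrightarrow> B v w = 0 \<Longrightarrow> g w = w"
    using exists_isometry_reflecting[OF 1 2] by (auto simp: B.minus_left)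
  have 3: "B (- v) (- v) = B v v" by (simp add: B.minus_left B.minus_right)
  have "B v v + B v v \<noteq> 0" using u q double by simp
  moreover have "B (- v - v) (- v) = B v v + B v v"
    by (simp add: B.minus_left B.minus_right B.diff_left)
  ultimately have 4: "B (- v - v) (- v) \<noteq> 0" by simp
  obtain h where h: "h \<in> isometries" "h (- v) = v" "\<And>w. B v w = 0 \<Longrightarrow> h w = w"
    using exists_isometry_reflecting[OF 3 4] by (auto simp: B.minus_left)
  have "h \<circ> g \<in> isometries" using g h by (simp add: isometries_comp)
  moreover have "(h \<circ> g) u = v" "\<And>w. B u w = 0 \<Longrightarrow> B v w = 0 \<Longrightarrow> (h \<circ> g) w = w"
    using g h by simp_all
  ultimately show ?thesis by blast
qed (rule exists_isometry_reflecting[OF q])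

text \<open>Once \<open>g\<close> matches the first \<open>n\<close> vectors, \<open>g (f n)\<close>
  and \<open>f' n\<close> are both orthogonal to those images, so an isometry moving one to the
  other leaves them fixed. The last hypothesis excludes nonzero isotropic members but admits zero
  vectors, so families need no pruning.\<close>

lemma exists_isometry_orthogonal_families:
  fixes f f' :: "nat \<Rightarrow> 'h"
  assumes "\<And>i j. i < n \<Longrightarrow> j < n \<Longrightarrow> i \<noteq> j \<Longrightarrow> B (f i) (f j) = 0"
    and "\<And>i j. i < n \<Longrightarrow> j < n \<Longrightarrow> i \<noteq> j \<Longrightarrow> B (f' i) (f' j) = 0"
    and "\<And>i. i < n \<Longrightarrow> B (f i) (f i) = B (f' i) (f' i)"
    and "\<And>i. i < n \<Longrightarrow> B (f i) (f i) = 0 \<Longrightarrow> f i = 0 \<and> f' i = 0"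
  shows "\<exists>g\<in>isometries. \<forall>i<n. g (f i) = f' i"
  using assms
proof (induction n)
  case 0
  show ?case using id_isometry by auto
next
  case (Suc n)
  have "\<exists>g\<in>isometries. \<forall>i<n. g (f i) = f' i"
    by (rule Suc.IH; rule Suc.prems) simp_all
  then obtain g where g: "g \<in> isometries" "\<forall>i<n. g (f i) = f' i" by blast
  show ?case
  proof (cases "B (f n) (f n) = 0")
    case True
    then have "f n = 0" "f' n = 0" using Suc.prems(4)[of n] by simp_all
    moreover have "g 0 = 0"
      using isometries_linearK[OF g(1)] by (simp add: bounded_linearK_def linear_simps)
    ultimately have "\<forall>i<Suc n. g (f i) = f' i" using g by (simp add: less_Suc_eq)
    with g show ?thesis by blast
  next
    case False
    have "B (g (f n)) (g (f n)) = B (f' n) (f' n)" "B (g (f n)) (g (f n)) \<noteq> 0"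
      using False Suc.prems(3)[of n] by (simp_all add: isometries_B[OF g(1)])
    then obtain h where h: "h \<in> isometries" "h (g (f n)) = f' n"
        "\<And>w. B (g (f n)) w = 0 \<Longrightarrow> B (f' n) w = 0 \<Longrightarrow> h w = w"
      using exists_isometry_moving by blast
    have "h (f' i) = f' i" if "i < n" for i
    proof (rule h(3))
      have "B (g (f n)) (f' i) = B (g (f n)) (g (f i))" using g that by simp
      also have "\<dots> = 0" using Suc.prems(1)[of n i] that by (simp add: isometries_B[OF g(1)])
      finally show "B (g (f n)) (f' i) = 0" .
      show "B (f' n) (f' i) = 0" using Suc.prems(2)[of n i] that by simp
    qed
    then have "\<forall>i<Suc n. (h \<circ> g) (f i) = f' i" using g h by (simp add: less_Suc_eq)
    then show ?thesis using isometries_comp[OF h(1) g(1)] by blast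
  qed
qed

end


section \<open>The form of signature \<open>(p, \<infinity>)\<close>\<close>

context right_hilbert_space
begin

lemma form_add_right: "form x (y + z) = form x y + form x z"
  using form_linear[of x y 1 z] ract_of_real[of y 1] by simp

lemma form_ract_right: "form x (ract y a) = form x y * a"
proof -
  have "form x 0 = 0" using form_add_right[of x 0 0] by simp
  then show ?thesis using form_linear[of x y a 0] by simp
qed

lemma form_ract_left: "form (ract x a) y = kconj a * form x y"
  by (subst (1 2) form_kconj) (simp add: form_ract_right kconj_mult)

lemma form_add_left: "form (x + y) z = form x z + form y z"
  by (subst (1 2 3) form_kconj) (simp add: form_add_right kconj_add)

lemma norm_ract: "norm (ract x a) = norm x * norm a"
proof -
  have "of_real ((norm (ract x a))\<^sup>2) = kconj a * (of_real ((norm x)\<^sup>2) * a)"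
    unfolding form_self[symmetric] by (simp only: form_ract_left form_ract_right mult.assoc)
  also have "\<dots> = of_real ((norm x)\<^sup>2) * (kconj a * a)"
    by (simp add: of_real_def)
  also have "\<dots> = of_real ((norm x * norm a)\<^sup>2)"
    by (simp only: kconj_mult_self_of_real of_real_mult power_mult_distrib)
  finally have "(norm (ract x a))\<^sup>2 = (norm x * norm a)\<^sup>2" by (simp only: of_real_eq_iff)
  then show ?thesis by (simp add: power2_eq_iff_nonneg)
qed

lemma Cauchy_Schwarz_form: "norm (form x y) \<le> norm x * norm y"
proof (cases "x = 0")
  case True
  then have "form x y = 0"
    using form_add_left[of 0 0 y] by simp
  then show ?thesis by simp
next
  case False
  \<comment> \<open>\<open>a\<close> is the coefficient that makes \<open>y + x a\<close> orthogonal
    to \<open>x\<close>; nonnegativity of its squared norm is the inequality.\<close>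
  define n c a where "n = (norm x)\<^sup>2" and "c = form x y" and "a = - (of_real (inverse n) * c)"
  have "n > 0" using False by (simp add: n_def)
  have "of_real ((norm (y + ract x a))\<^sup>2) =
      form y y + form y x * a + kconj a * form x y + kconj a * form x x * a"
    unfolding form_self[symmetric]
    by (simp add: form_add_left form_add_right form_ract_left form_ract_right distrib_right
        mult.assoc)
  also have "kconj a * form x x * a = - (kconj a * c)"
  proof -
    have "form x x * a = - (of_real (n * inverse n) * c)"
      unfolding form_self a_def n_def[symmetric] of_real_mult by (simp add: mult.assoc)
    then show ?thesis using \<open>n > 0\<close> by (simp add: mult.assoc)
  qed
  also have "form y x * a = - of_real ((norm c)\<^sup>2 / n)"
  proof -
    have "form y x * a = - (kconj c * (of_real (inverse n) * c))"
      unfolding a_def c_def form_kconj[of y x] by simp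
    also have "kconj c * (of_real (inverse n) * c) = of_real (inverse n) * (kconj c * c)"
      by (simp only: of_real_def) simp
    finally show ?thesis
      by (simp only: kconj_mult_self_of_real divide_inverse of_real_mult[symmetric] mult.commute)
  qed
  finally have "of_real ((norm (y + ract x a))\<^sup>2) = form y y - of_real ((norm c)\<^sup>2 / n)"
    unfolding c_def by simp
  then have "(norm (y + ract x a))\<^sup>2 = (norm y)\<^sup>2 - (norm c)\<^sup>2 / n"
    by (simp only: form_self of_real_diff[symmetric] of_real_eq_iff)
  then have "(norm c)\<^sup>2 / n \<le> (norm y)\<^sup>2"
    using zero_le_power2[of "norm (y + ract x a)"] by simp
  then have "(norm c)\<^sup>2 \<le> (norm x * norm y)\<^sup>2"
    using \<open>n > 0\<close> by (simp add: pos_divide_le_eq power_mult_distrib n_def mult.commute)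
  then show ?thesis unfolding c_def by (rule power2_le_imp_le) simp
qed

sublocale form: hermitian_space ract form
proof
  show "\<exists>K. \<forall>a b. norm (ract a b) \<le> norm a * norm b * K"
    by (intro exI[of _ 1]) (simp add: norm_ract)
  show "\<exists>K. \<forall>a b. norm (form a b) \<le> norm a * norm b * K"
    by (intro exI[of _ 1]) (simp add: Cauchy_Schwarz_form)
  have scale: "r *\<^sub>R x = ract x (of_real r)" for r x by (simp add: ract_of_real)
  show "ract (r *\<^sub>R x) b = r *\<^sub>R ract x b" "ract x (r *\<^sub>R b) = r *\<^sub>R ract x b" for r x b
    unfolding scale ract_ract by (simp_all add: of_real_def)
  show "form (r *\<^sub>R x) y = r *\<^sub>R form x y" "form x (r *\<^sub>R y) = r *\<^sub>R form x y" for r x y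
    unfolding scale form_ract_left form_ract_right
    by (simp_all only: kconj_of_real) (simp_all add: of_real_def)
  show "form x y = kconj (form y x)" for x y by (rule form_kconj)
  show "ract (a + a') b = ract a b + ract a' b" for a a' b by (rule ract_add_left)
  show "ract a (b + b') = ract a b + ract a b'" for a b b' by (rule ract_add_right)
  show "ract (ract x a) b = ract x (a * b)" for x a b by (rule ract_ract)
  show "ract x (of_real r) = r *\<^sub>R x" for r x by (rule ract_of_real)
  show "form (a + a') b = form a b + form a' b" for a a' b by (rule form_add_left)
  show "form a (b + b') = form a b + form a b'" for a b b' by (rule form_add_right)
  show "form x (ract y a) = form x y * a" for x y a by (rule form_ract_right)
qed

lemma positive_on_form: "form.positive_on E"
  by (simp add: form.positive_on_def form_self del: of_real_power)

end

locale signature_space = right_hilbert_space ract form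
  for ract :: "'h::banach \<Rightarrow> 'k::hilbert_scalar \<Rightarrow> 'h" and form :: "'h \<Rightarrow> 'h \<Rightarrow> 'k" +
  fixes E0 :: "'h set" and p :: nat
  assumes dim_E0: "has_dimK ract E0 p"
begin

abbreviation "\<Phi> \<equiv> Phi form E0"
abbreviation "\<B> \<equiv> Bform form E0"

text \<open>\<open>\<Phi>\<close> is \<open>2 P - 1\<close> for the orthogonal projection
  \<open>P\<close> onto \<open>E0\<close>. The \<open>THE\<close> is resolved because pairing
  \<open>x = u + v\<close> with the basis determines the coordinates of \<open>u\<close>.\<close>

lemma Phi_eq:
  assumes b: "form.orthonormal p b" "\<And>i. i < p \<Longrightarrow> b i \<in> E0"
  shows "\<Phi> x = 2 *\<^sub>R (\<Sum>i<p. ract (b i) (form (b i) x)) - x"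
proof -
  let ?P = "\<lambda>x. \<Sum>i<p. ract (b i) (form (b i) x)"
  have sub: "subspaceK ract E0" using dim_E0 by (simp add: has_dimK_def)
  have expansion: "u = ?P u" if "u \<in> E0" for u
    using form.orthonormal_expansion[OF dim_E0 positive_on_form b that] .
  have P: "?P x \<in> E0" for x
    using b(2) by (intro form.subspaceK_comb sub) auto
  have bP: "form (b i) (x - ?P x) = 0" if "i < p" for i
    using that by (simp add: form.B.diff_right form.orthonormal_coeff[OF b(1)])
  have perp: "x - ?P x \<in> orth_compl form E0"
  proof -
    have "form u (x - ?P x) = 0" if "u \<in> E0" for u
      by (subst expansion[OF that]) (simp add: form.B_comb_left bP)
    then show ?thesis by (simp add: orth_compl_def)
  qed
  have unique: "u = ?P x" if "u \<in> E0" "v \<in> orth_compl form E0" "x = u + v" for u v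
  proof -
    have "form (b i) x = form (b i) u" if "i < p" for i
      using \<open>v \<in> orth_compl form E0\<close> b(2)[OF that]
      by (simp add: \<open>x = u + v\<close> form_add_right orth_compl_def)
    then show ?thesis using expansion[OF that(1)] by simp
  qed
  show ?thesis
    unfolding Phi_def
  proof (rule the_equality)
    show "\<exists>u\<in>E0. \<exists>v\<in>orth_compl form E0. x = u + v \<and> 2 *\<^sub>R ?P x - x = u - v"
      by (intro bexI[of _ "?P x"] bexI[of _ "x - ?P x"] P perp) (simp add: scaleR_2)
    show "z = 2 *\<^sub>R ?P x - x"
      if z: "\<exists>u\<in>E0. \<exists>v\<in>orth_compl form E0. x = u + v \<and> z = u - v" for z
    proof -
      obtain u v where uv: "u \<in> E0" "v \<in> orth_compl form E0" "x = u + v" "z = u - v"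
        using z by blast
      have "z = 2 *\<^sub>R u - x" using uv by (simp add: scaleR_2)
      with unique[OF uv(1-3)] show ?thesis by simp
    qed
  qed
qed

lemma obtain_E0_basis:
  obtains b where "form.orthonormal p b" "\<And>i. i < p \<Longrightarrow> b i \<in> E0"
  using form.exists_orthonormal[OF dim_E0 positive_on_form order_refl] by blast

lemma bounded_linear_Phi: "bounded_linear \<Phi>"
proof -
  obtain b where b: "form.orthonormal p b" "\<And>i. i < p \<Longrightarrow> b i \<in> E0"
    using obtain_E0_basis by blast
  have "bounded_linear (\<lambda>x. 2 *\<^sub>R (\<Sum>i<p. ract (b i) (form (b i) x)) - x)"
    by (intro bounded_linear_sub bounded_linear_ident bounded_linear_sum
        bounded_linear_compose[OF bounded_linear_scaleR_right]
        bounded_linear_compose[OF form.ract.bounded_linear_right] form.B.bounded_linear_right)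
  also have "(\<lambda>x. 2 *\<^sub>R (\<Sum>i<p. ract (b i) (form (b i) x)) - x) = \<Phi>"
    by (simp add: fun_eq_iff Phi_eq[OF b])
  finally show ?thesis .
qed

lemma Phi_ract: "\<Phi> (ract x a) = ract (\<Phi> x) a"
proof -
  obtain b where b: "form.orthonormal p b" "\<And>i. i < p \<Longrightarrow> b i \<in> E0"
    using obtain_E0_basis by blast
  show ?thesis
    by (simp add: Phi_eq[OF b] form_ract_right form.ract.sum_left form.ract.diff_left
        form.ract.scaleR_left ract_ract)
qed

lemma Phi_self_adjoint: "form (\<Phi> x) y = form x (\<Phi> y)"
proof -
  obtain b where b: "form.orthonormal p b" "\<And>i. i < p \<Longrightarrow> b i \<in> E0"
    using obtain_E0_basis by blast
  show ?thesis
    by (simp add: Phi_eq[OF b] form.B.diff_left form.B.diff_right form.B.scaleR_left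
        form.B.scaleR_right form.B_comb_left form.B_comb_right flip: form_kconj)
qed

lemma Phi_Phi: "\<Phi> (\<Phi> x) = x"
proof -
  obtain b where b: "form.orthonormal p b" "\<And>i. i < p \<Longrightarrow> b i \<in> E0"
    using obtain_E0_basis by blast
  have "form (b j) (\<Phi> x) = form (b j) x" if "j < p" for j
    using that by (simp add: Phi_eq[OF b] form.B.diff_right form.B.scaleR_right
        form.orthonormal_coeff[OF b(1)]) (simp add: scaleR_2)
  then have "(\<Sum>i<p. ract (b i) (form (b i) (\<Phi> x))) = (\<Sum>i<p. ract (b i) (form (b i) x))"
    by (intro sum.cong) auto
  then show ?thesis
    using Phi_eq[OF b, of "\<Phi> x"] Phi_eq[OF b, of x] by simp
qed

lemma B_adjoint: "\<B> x y = form (\<Phi> x) y"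
  by (simp add: Bform_def Phi_self_adjoint)

sublocale Bf: hermitian_space ract \<B>
proof
  have bil: "bounded_bilinear \<B>"
    unfolding Bform_def
    by (rule bounded_bilinear.comp[OF form.B_bilinear bounded_linear_ident bounded_linear_Phi])
  interpret bounded_bilinear \<B> by (rule bil)
  show "\<B> (a + a') b = \<B> a b + \<B> a' b" "\<B> a (b + b') = \<B> a b + \<B> a b'"
    "\<B> (r *\<^sub>R a) b = r *\<^sub>R \<B> a b" "\<B> a (r *\<^sub>R b) = r *\<^sub>R \<B> a b" for a a' b b' r
    by (rule add_left add_right scaleR_left scaleR_right)+
  show "\<exists>K. \<forall>a b. norm (\<B> a b) \<le> norm a * norm b * K" by (rule bounded)
  show "\<B> x (ract y a) = \<B> x y * a" for x y a
    by (simp add: Bform_def Phi_ract form_ract_right)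
  show "\<B> x y = kconj (\<B> y x)" for x y
    unfolding B_adjoint[of x y] Bform_def[of form E0 y x] by (rule form_kconj)
qed (rule ract_ract ract_of_real)+

text \<open>The vectors \<open>f i = \<Phi> (b i)\<close> satisfy
  \<open>\<B> (f i) z = form (b i) z\<close>, so their common kernel is the Hilbert orthogonal of
  \<open>E0\<close>, where \<open>\<Phi>\<close> is \<open>-1\<close>. In this shape codimension
  \<open>p\<close> becomes \<open>p\<close> equations of a linear system.\<close>

lemma negative_functionals:
  obtains f :: "nat \<Rightarrow> 'h" where "\<And>z. (\<And>i. i < p \<Longrightarrow> \<B> (f i) z = 0) \<Longrightarrow> z \<noteq> 0 \<Longrightarrow> kre (\<B> z z) < 0"
proof -
  obtain b where b: "form.orthonormal p b" "\<And>i. i < p \<Longrightarrow> b i \<in> E0"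
    using obtain_E0_basis by blast
  have neg: "kre (\<B> z z) < 0" if z: "\<And>i. i < p \<Longrightarrow> \<B> (\<Phi> (b i)) z = 0" "z \<noteq> 0" for z
  proof -
    have "form (b i) z = 0" if "i < p" for i
      using z(1)[OF that] by (simp add: B_adjoint Phi_Phi)
    then have "\<Phi> z = - z" by (simp add: Phi_eq[OF b] form.ract.zero_right)
    then have "\<B> z z = - of_real ((norm z)\<^sup>2)"
      by (simp add: Bform_def form.B.minus_right form_self)
    with z(2) show ?thesis by (simp only: kre_minus kre_of_real) simp
  qed
  show thesis by (rule that[of "\<lambda>i. \<Phi> (b i)"]) (rule neg)
qed

lemma Op_inf_eq_isometries: "Op_inf ract form E0 = Bf.isometries"
proof (intro equalityI subsetI)
  fix g assume g: "g \<in> Op_inf ract form E0"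
  then obtain gs where gs: "is_adjoint form g gs" "gs \<circ> \<Phi> \<circ> g = \<Phi>" by (auto simp: Op_inf_def)
  have "\<B> (g x) (g y) = \<B> x y" for x y
  proof -
    have "form u (g x) = form (gs u) x" for u x using gs(1) by (simp add: is_adjoint_def)
    then have adj: "form (g x) u = form x (gs u)" for u x
      by (subst (1 2) form_kconj) simp
    have "gs (\<Phi> (g y)) = \<Phi> y" using gs(2) by (simp add: fun_eq_iff)
    then show ?thesis by (simp add: Bform_def adj)
  qed
  with g show "g \<in> Bf.isometries" by (simp add: Op_inf_def Bf.isometries_def)
next
  fix g assume g: "g \<in> Bf.isometries"
  then obtain h where h: "bounded_linearK ract h" "g \<circ> h = id" "h \<circ> g = id"
    by (auto simp: Bf.isometries_def)
  \<comment> \<open>The adjoint is explicit: since \<open>\<Phi>\<close> is an involution, the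
    relation for \<open>g\<^sup>*\<close> solves to \<open>\<Phi> \<circ> h \<circ> \<Phi>\<close>
    with \<open>h\<close> the inverse of \<open>g\<close>.\<close>
  have "form (\<Phi> (h (\<Phi> x))) y = form x (g y)" for x y
  proof -
    have "form (\<Phi> (h (\<Phi> x))) y = \<B> (h (\<Phi> x)) y" by (rule B_adjoint[symmetric])
    also have "\<dots> = \<B> (g (h (\<Phi> x))) (g y)" by (rule Bf.isometries_B[OF g, symmetric])
    also have "g (h (\<Phi> x)) = \<Phi> x" using h by (simp add: fun_eq_iff)
    finally show ?thesis by (simp add: B_adjoint Phi_Phi)
  qed
  then have "is_adjoint form g (\<Phi> \<circ> h \<circ> \<Phi>)" by (simp add: is_adjoint_def)
  moreover have "\<Phi> \<circ> h \<circ> \<Phi> \<circ> \<Phi> \<circ> g = \<Phi>"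
    using h by (simp add: fun_eq_iff Phi_Phi)
  ultimately show "g \<in> Op_inf ract form E0"
    using h Bf.isometries_linearK[OF g] unfolding Op_inf_def by blast
qed

section \<open>Positive subspaces of dimension \<open>p\<close> and their orthogonals\<close>

lemma Xp_dim: "E \<in> Xp ract form E0 p \<Longrightarrow> has_dimK ract E p"
  by (simp add: Xp_def)

lemma Xp_subspace: "E \<in> Xp ract form E0 p \<Longrightarrow> subspaceK ract E"
  by (simp add: Xp_def has_dimK_def)

lemma Xp_positive:
  assumes "E \<in> Xp ract form E0 p"
  shows "Bf.positive_on E"
  unfolding Bf.positive_on_def
proof (intro ballI impI)
  fix x assume "x \<in> E" "x \<noteq> 0"
  then obtain r where "r > 0" "\<B> x x = of_real r"
    using assms unfolding Xp_def Qform_def by blast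
  then show "kre (\<B> x x) > 0" by simp
qed

text \<open>Otherwise \<open>E\<close> and \<open>w\<close> span a nonnegative subspace of dimension \<open>p + 1\<close>, which meets
  the negative subspace \<open>E0\<^sup>\<bottom>\<close> of codimension \<open>p\<close>.\<close>

lemma Xp_orthogonal_negative:
  assumes E: "E \<in> Xp ract form E0 p" and w: "\<And>e. e \<in> E \<Longrightarrow> \<B> e w = 0" "w \<noteq> 0"
  shows "kre (\<B> w w) < 0"
proof (rule ccontr)
  assume "\<not> kre (\<B> w w) < 0"
  then have "kre (\<B> w w) \<ge> 0" by simp
  obtain b where b: "Bf.orthonormal p b" "\<forall>i<p. b i \<in> E"
    using Bf.exists_orthonormal[OF Xp_dim[OF E] Xp_positive[OF E] order_refl] by blast
  obtain f where f: "\<And>z. (\<And>i. i < p \<Longrightarrow> \<B> (f i) z = 0) \<Longrightarrow> z \<noteq> 0 \<Longrightarrow> kre (\<B> z z) < 0"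
    using negative_functionals by blast
  define v where "v = b(p := w)"
  have bw: "\<B> (b i) w = 0" if "i < p" for i using that b w by blast
  have orth: "\<B> (v i) (v j) = 0" if "i \<le> p" "j \<le> p" "i \<noteq> j" for i j
    using that b(1) bw Bf.B_eq_zero_commute[of w]
    by (auto simp: v_def Bf.orthonormal_def)
  have nonneg: "kre (\<B> (v i) (v i)) \<ge> 0" if "i \<le> p" for i
    using that b(1) \<open>kre (\<B> w w) \<ge> 0\<close> by (auto simp: v_def Bf.orthonormal_def)
  obtain a k where a: "k \<le> p" "a k \<noteq> 0" "\<And>i. i < p \<Longrightarrow> (\<Sum>j\<le>p. \<B> (f i) (v j) * a j) = 0"
    using homogeneous_system_solution[of "{..<p}" "{..p}" "\<lambda>i j. \<B> (f i) (v j)"] by auto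
  define z where "z = (\<Sum>j\<le>p. ract (v j) (a j))"
  have "\<B> (f i) z = 0" if "i < p" for i
    using a(3)[OF that] by (simp add: z_def Bf.B_comb_right)
  moreover have "z \<noteq> 0"
  proof
    assume "z = 0"
    have coeff: "a j = 0" if "j < p" for j
    proof -
      have "(\<Sum>i\<in>{..p} - {j}. \<B> (v j) (v i) * a i) = 0"
        using that orth by (intro sum.neutral) auto
      then have "\<B> (v j) z = \<B> (v j) (v j) * a j"
        unfolding z_def Bf.B_comb_right using that by (subst sum.remove[of _ j]) auto
      then show ?thesis
        using that b(1) \<open>z = 0\<close> by (simp add: v_def Bf.orthonormal_def Bf.B.zero_right)
    qed
    \<comment> \<open>\<open>w\<close> may be isotropic, so pairing with it would not give the
      coefficient at \<open>p\<close>; that one is found only after the others have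
      vanished.\<close>
    then have "z = ract w (a p)"
      by (simp add: z_def v_def form.ract.zero_right flip: lessThan_Suc_atMost)
    with \<open>z = 0\<close> w(2) have "a p = 0" by (simp add: Bf.ract_eq_0_iff)
    with coeff a(1,2) show False by (metis le_neq_implies_less)
  qed
  ultimately have "kre (\<B> z z) < 0" using f by blast
  moreover have "kre (\<B> z z) \<ge> 0"
    unfolding z_def using orth nonneg
    by (subst Bf.B_self_comb_orthogonal) (auto simp del: of_real_sum of_real_mult intro!: sum_nonneg)
  ultimately show False by simp
qed


section \<open>Principal runs\<close>

text \<open>A real \<open>Sup\<close> bounds its set from above only if the set is bounded; this
  provides the bound for all stages of a run at once.\<close>

lemma bounded_on_spheres:
  assumes E: "E \<in> Xp ract form E0 p" and F: "F \<in> Xp ract form E0 p"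
  shows "\<exists>M. \<forall>u\<in>E. \<forall>v\<in>F. \<B> u u = 1 \<longrightarrow> \<B> v v = 1 \<longrightarrow> kre (\<B> u v) \<le> M"
proof -
  let ?S = "\<lambda>E. {u \<in> E. \<B> u u = 1}"
  have "compact ((\<lambda>(u, v). norm (\<B> u v)) ` (?S E \<times> ?S F))"
    by (intro compact_continuous_image compact_Times Bf.compact_unit_sphere[OF Xp_dim Xp_positive] E F)
      (auto simp: case_prod_beta intro!: continuous_intros Bf.B.continuous_on)
  then have "bdd_above ((\<lambda>(u, v). norm (\<B> u v)) ` (?S E \<times> ?S F))"
    by (intro bounded_imp_bdd_above compact_imp_bounded)
  then obtain M where M: "\<forall>t\<in>(\<lambda>(u, v). norm (\<B> u v)) ` (?S E \<times> ?S F). t \<le> M"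
    unfolding bdd_above_def by blast
  have "kre (\<B> u v) \<le> M" if "u \<in> ?S E" "v \<in> ?S F" for u v
  proof -
    have "(case (u, v) of (u, v) \<Rightarrow> norm (\<B> u v)) \<le> M" using that by (intro bspec[OF M] imageI) simp
    then show ?thesis using kre_le_norm[of "\<B> u v"] by simp
  qed
  then show ?thesis by blast
qed

text \<open>A pair maximising \<open>norm (\<B> u v)\<close> can be rotated by a unit scalar so that \<open>\<B> u v\<close> becomes
  a nonnegative real.\<close>

lemma Sup_attained:
  assumes E: "E \<in> Xp ract form E0 p" and F: "F \<in> Xp ract form E0 p"
    and ne: "\<exists>u\<in>B_orth form E0 X E. \<B> u u = 1" "\<exists>v\<in>B_orth form E0 Y F. \<B> v v = 1"
  shows "\<exists>u\<in>B_orth form E0 X E. \<exists>v\<in>B_orth form E0 Y F. \<B> u u = 1 \<and> \<B> v v = 1 \<and>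
    \<B> u v = of_real (Sup {kre (\<B> u v) | u v. u \<in> B_orth form E0 X E \<and> v \<in> B_orth form E0 Y F \<and>
      \<B> u u = 1 \<and> \<B> v v = 1})"
proof -
  let ?S = "\<lambda>X E. {u \<in> B_orth form E0 X E. \<B> u u = 1}"
  have compact: "compact (?S X E)" if "E \<in> Xp ract form E0 p" for X E
  proof -
    have "closed (\<Inter>x\<in>X. {u. \<B> x u = 0})"
      by (intro closed_INT ballI closed_Collect_eq continuous_intros Bf.B.continuous_on)
    then have "compact ({u \<in> E. \<B> u u = 1} \<inter> (\<Inter>x\<in>X. {u. \<B> x u = 0}))"
      using Bf.compact_unit_sphere[OF Xp_dim Xp_positive] that by (intro compact_Int_closed)
    also have "{u \<in> E. \<B> u u = 1} \<inter> (\<Inter>x\<in>X. {u. \<B> x u = 0}) = ?S X E"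
      by (auto simp: B_orth_def)
    finally show ?thesis .
  qed
  have "\<exists>w\<in>?S X E \<times> ?S Y F. \<forall>w'\<in>?S X E \<times> ?S Y F.
      norm (\<B> (fst w') (snd w')) \<le> norm (\<B> (fst w) (snd w))"
  proof (rule continuous_attains_sup)
    show "compact (?S X E \<times> ?S Y F)" by (intro compact_Times compact E F)
    show "?S X E \<times> ?S Y F \<noteq> {}" using ne by auto
    show "continuous_on (?S X E \<times> ?S Y F) (\<lambda>w. norm (\<B> (fst w) (snd w)))"
      by (intro continuous_intros Bf.B.continuous_on)
  qed
  then obtain u v where u: "u \<in> ?S X E" and v: "v \<in> ?S Y F"
    and max: "\<And>u' v'. u' \<in> ?S X E \<Longrightarrow> v' \<in> ?S Y F \<Longrightarrow> norm (\<B> u' v') \<le> norm (\<B> u v)"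
    by fastforce
  define m where "m = norm (\<B> u v)"
  \<comment> \<open>For \<open>m \<noteq> 0\<close> this is the unit scalar with
    \<open>\<B> u v * b = m\<close>; for \<open>m = 0\<close> any unit scalar would do.\<close>
  define b where "b = (if m = 0 then 1 else kconj (\<B> u v) * of_real (inverse m))"
  have nb: "norm b = 1"
    by (auto simp: b_def m_def norm_mult simp del: of_real_inverse)
  have Bb: "\<B> u v * b = of_real m"
  proof (cases "m = 0")
    case False
    have "\<B> u v * b = of_real (m\<^sup>2) * of_real (inverse m)"
      using False by (simp add: b_def m_def mult_kconj_self flip: mult.assoc)
    also have "\<dots> = of_real m"
      unfolding of_real_mult[symmetric] of_real_eq_iff using False by (simp add: power2_eq_square)
    finally show ?thesis .
  qed (simp add: m_def)
  define v' where "v' = ract v b"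
  have v': "v' \<in> ?S Y F"
  proof -
    have "\<B> v' v' = 1" using v nb by (simp add: v'_def Bf.B_self_ract)
    moreover have "v' \<in> F" using v Xp_subspace[OF F] by (simp add: v'_def subspaceK_def B_orth_def)
    moreover have "\<forall>y\<in>Y. \<B> y v' = 0" using v by (simp add: v'_def B_orth_def Bf.B_ract_right)
    ultimately show ?thesis by (simp add: B_orth_def)
  qed
  have uv': "\<B> u v' = of_real m" by (simp add: v'_def Bf.B_ract_right Bb)
  have "Sup {kre (\<B> u v) | u v. u \<in> B_orth form E0 X E \<and> v \<in> B_orth form E0 Y F \<and>
      \<B> u u = 1 \<and> \<B> v v = 1} = m"
  proof (rule cSup_eq_maximum)
    have "m = kre (\<B> u v')" by (simp add: uv')
    with u v' show "m \<in> {kre (\<B> u v) | u v. u \<in> B_orth form E0 X E \<and> v \<in> B_orth form E0 Y F \<and>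
        \<B> u u = 1 \<and> \<B> v v = 1}" by blast
  next
    fix t assume "t \<in> {kre (\<B> u v) | u v. u \<in> B_orth form E0 X E \<and> v \<in> B_orth form E0 Y F \<and>
        \<B> u u = 1 \<and> \<B> v v = 1}"
    then obtain u1 v1 where "t = kre (\<B> u1 v1)" "u1 \<in> ?S X E" "v1 \<in> ?S Y F" by blast
    then show "t \<le> m" using max kre_le_norm[of "\<B> u1 v1"] by (fastforce simp: m_def)
  qed
  with u v' uv' show ?thesis by blast
qed

lemma principal_run_iff:
  "principal_run form E0 n E F x y c \<longleftrightarrow>
    (\<forall>l<n. c l = Sup {kre (\<B> u v) | u v. u \<in> B_orth form E0 (x ` {..<l}) E \<and>
          v \<in> B_orth form E0 (y ` {..<l}) F \<and> \<B> u u = 1 \<and> \<B> v v = 1} \<and>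
        x l \<in> B_orth form E0 (x ` {..<l}) E \<and> y l \<in> B_orth form E0 (y ` {..<l}) F \<and>
        \<B> (x l) (x l) = 1 \<and> \<B> (y l) (y l) = 1 \<and> \<B> (x l) (y l) = of_real (c l))"
  by (simp add: principal_run_def Qform_def Let_def)

lemma principal_run_cong:
  assumes "\<And>l. l < n \<Longrightarrow> x l = x' l" "\<And>l. l < n \<Longrightarrow> y l = y' l" "\<And>l. l < n \<Longrightarrow> c l = c' l"
  shows "principal_run form E0 n E F x y c \<longleftrightarrow> principal_run form E0 n E F x' y' c'"
proof -
  have "x ` {..<l} = x' ` {..<l}" "y ` {..<l} = y' ` {..<l}" if "l < n" for l
    using that assms by (auto intro!: image_cong)
  with assms show ?thesis unfolding principal_run_iff by simp
qed

text \<open>Induction on the length: at stage \<open>n < p\<close> both orthogonals still contain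
  unit vectors, and an attained supremum supplies the next pair.\<close>

lemma principal_run_exists:
  assumes E: "E \<in> Xp ract form E0 p" and F: "F \<in> Xp ract form E0 p"
  shows "\<exists>x y c. principal_run form E0 p E F x y c"
proof -
  have "\<exists>x y c. principal_run form E0 n E F x y c" if "n \<le> p" for n
    using that
  proof (induction n)
    case 0
    show ?case by (simp add: principal_run_iff)
  next
    case (Suc n)
    then obtain x y c where run: "principal_run form E0 n E F x y c" by auto
    have n: "n < p" using Suc.prems by simp
    have "\<exists>u\<in>B_orth form E0 (x ` {..<n}) E. \<B> u u = 1"
      using Bf.exists_orthonormal_extension[OF Xp_dim[OF E] Xp_positive[OF E] n, of x]
      by (auto simp: B_orth_def)
    moreover have "\<exists>v\<in>B_orth form E0 (y ` {..<n}) F. \<B> v v = 1"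
      using Bf.exists_orthonormal_extension[OF Xp_dim[OF F] Xp_positive[OF F] n, of y]
      by (auto simp: B_orth_def)
    ultimately obtain u v where uv: "u \<in> B_orth form E0 (x ` {..<n}) E"
        "v \<in> B_orth form E0 (y ` {..<n}) F" "\<B> u u = 1" "\<B> v v = 1"
        "\<B> u v = of_real (Sup {kre (\<B> u v) | u v. u \<in> B_orth form E0 (x ` {..<n}) E \<and>
          v \<in> B_orth form E0 (y ` {..<n}) F \<and> \<B> u u = 1 \<and> \<B> v v = 1})"
      using Sup_attained[OF E F, of "x ` {..<n}" "y ` {..<n}"] by blast
    define s where "s = Sup {kre (\<B> u v) | u v. u \<in> B_orth form E0 (x ` {..<n}) E \<and>
          v \<in> B_orth form E0 (y ` {..<n}) F \<and> \<B> u u = 1 \<and> \<B> v v = 1}"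
    define x' y' c' where "x' = x(n := u)" and "y' = y(n := v)" and "c' = c(n := s)"
    have run': "principal_run form E0 n E F x' y' c'"
      using run by (subst principal_run_cong[of n x' x y' y c' c]) (auto simp: x'_def y'_def c'_def)
    have img: "x' ` {..<n} = x ` {..<n}" "y' ` {..<n} = y ` {..<n}"
      by (auto simp: x'_def y'_def)
    have "x' n = u" "y' n = v" "c' n = s" by (simp_all add: x'_def y'_def c'_def)
    with uv run' have "principal_run form E0 (Suc n) E F x' y' c'"
      unfolding principal_run_iff less_Suc_eq by (auto simp: img simp flip: s_def)
    then show ?case by blast
  qed
  then show ?thesis by blast
qed

text \<open>Allows statements about \<open>E\<close> to be transferred to \<open>F\<close>; the real
  part is insensitive to the conjugation that swaps the arguments.\<close>

lemma principal_run_sym: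
  assumes "principal_run form E0 n E F x y c"
  shows "principal_run form E0 n F E y x c"
proof -
  have "{kre (\<B> v u) | v u. v \<in> C \<and> u \<in> D \<and> \<B> v v = 1 \<and> \<B> u u = 1} =
      {kre (\<B> u v) | u v. u \<in> D \<and> v \<in> C \<and> \<B> u u = 1 \<and> \<B> v v = 1}" for C D
  proof -
    have *: "kre (\<B> v u) = kre (\<B> u v)" for u v
      using Bf.B_kconj[of v u] by simp
    show ?thesis by (intro Collect_cong) (metis *)
  qed
  moreover have "\<B> (y l) (x l) = of_real (c l)" if "\<B> (x l) (y l) = of_real (c l)" for l
    using Bf.B_kconj[of "y l" "x l"] that by simp
  ultimately show ?thesis
    using assms unfolding principal_run_iff by simp
qed

lemma principal_run_image:
  assumes g: "g \<in> Bf.isometries" and run: "principal_run form E0 n E F x y c"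
  shows "principal_run form E0 n (g ` E) (g ` F) (g \<circ> x) (g \<circ> y) c"
proof -
  have orth: "B_orth form E0 ((g \<circ> z) ` L) (g ` G) = g ` B_orth form E0 (z ` L) G"
    for z :: "nat \<Rightarrow> 'h" and L G
    by (auto simp: B_orth_def Bf.isometries_B[OF g])
  have "{kre (\<B> u v) | u v. u \<in> g ` C \<and> v \<in> g ` D \<and> \<B> u u = 1 \<and> \<B> v v = 1} =
      {kre (\<B> u v) | u v. u \<in> C \<and> v \<in> D \<and> \<B> u u = 1 \<and> \<B> v v = 1}" for C D
  proof (intro equalityI subsetI)
    fix t assume "t \<in> {kre (\<B> u v) | u v. u \<in> C \<and> v \<in> D \<and> \<B> u u = 1 \<and> \<B> v v = 1}"
    then obtain u v where "t = kre (\<B> (g u) (g v))" "u \<in> C" "v \<in> D"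
      "\<B> (g u) (g u) = 1" "\<B> (g v) (g v) = 1" by (auto simp: Bf.isometries_B[OF g])
    then show "t \<in> {kre (\<B> u v) | u v. u \<in> g ` C \<and> v \<in> g ` D \<and> \<B> u u = 1 \<and> \<B> v v = 1}"
      by blast
  next
    fix t assume "t \<in> {kre (\<B> u v) | u v. u \<in> g ` C \<and> v \<in> g ` D \<and> \<B> u u = 1 \<and> \<B> v v = 1}"
    then obtain u v where "t = kre (\<B> u v)" "u \<in> C" "v \<in> D" "\<B> u u = 1" "\<B> v v = 1"
      by (auto simp: Bf.isometries_B[OF g])
    then show "t \<in> {kre (\<B> u v) | u v. u \<in> C \<and> v \<in> D \<and> \<B> u u = 1 \<and> \<B> v v = 1}"
      by blast
  qed
  with run show ?thesis
    unfolding principal_run_iff orth by (simp add: Bf.isometries_B[OF g])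
qed

section \<open>Vectors and numbers of a single run\<close>

context
  fixes E F x y c
  assumes E: "E \<in> Xp ract form E0 p" and F: "F \<in> Xp ract form E0 p"
    and run: "principal_run form E0 p E F x y c"
begin

lemma run_in: "l < p \<Longrightarrow> x l \<in> E" "l < p \<Longrightarrow> y l \<in> F"
  using run by (auto simp: principal_run_iff B_orth_def)

lemma run_c: "l < p \<Longrightarrow> \<B> (x l) (y l) = of_real (c l)"
  using run by (auto simp: principal_run_iff)

lemma run_orthonormal: "Bf.orthonormal p x" "Bf.orthonormal p y"
proof -
  have *: "\<B> (x i) (x j) = 0" "\<B> (y i) (y j) = 0" if "i < j" "j < p" for i j
    using run that by (auto simp: principal_run_iff B_orth_def)
  then have "\<B> (x j) (x i) = 0" "\<B> (y j) (y i) = 0" if "i < j" "j < p" for i j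
    using that by (simp_all add: Bf.B_eq_zero_commute[of "x j"] Bf.B_eq_zero_commute[of "y j"])
  with * run show "Bf.orthonormal p x" "Bf.orthonormal p y"
    unfolding Bf.orthonormal_def by (auto simp: principal_run_iff neq_iff)
qed

lemma run_expansion:
  "u \<in> E \<Longrightarrow> u = (\<Sum>i<p. ract (x i) (\<B> (x i) u))" "v \<in> F \<Longrightarrow> v = (\<Sum>i<p. ract (y i) (\<B> (y i) v))"
  using Bf.orthonormal_expansion[OF Xp_dim Xp_positive, of E x] E
    Bf.orthonormal_expansion[OF Xp_dim Xp_positive, of F y] F run_orthonormal run_in by blast+

lemma run_le:
  assumes "l < p" "u \<in> E" "\<And>i. i < l \<Longrightarrow> \<B> (x i) u = 0" "\<B> u u = 1"
    and "v \<in> F" "\<And>i. i < l \<Longrightarrow> \<B> (y i) v = 0" "\<B> v v = 1"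
  shows "kre (\<B> u v) \<le> c l"
proof -
  let ?A = "{kre (\<B> u v) | u v. u \<in> B_orth form E0 (x ` {..<l}) E \<and>
          v \<in> B_orth form E0 (y ` {..<l}) F \<and> \<B> u u = 1 \<and> \<B> v v = 1}"
  obtain M where "\<forall>u\<in>E. \<forall>v\<in>F. \<B> u u = 1 \<longrightarrow> \<B> v v = 1 \<longrightarrow> kre (\<B> u v) \<le> M"
    using bounded_on_spheres[OF E F] by blast
  then have "bdd_above ?A" unfolding bdd_above_def B_orth_def by blast
  moreover have "kre (\<B> u v) \<in> ?A" using assms by (auto simp: B_orth_def)
  ultimately have "kre (\<B> u v) \<le> Sup ?A" by (rule cSup_upper[rotated])
  also have "Sup ?A = c l" using run \<open>l < p\<close> unfolding principal_run_iff by simp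
  finally show ?thesis .
qed

text \<open>The pair \<open>x m\<close>, \<open>y m\<close> already competes for the supremum at
  stage \<open>l\<close>.\<close>

lemma run_antitone:
  assumes "l \<le> m" "m < p"
  shows "c m \<le> c l"
proof -
  have "kre (\<B> (x m) (y m)) \<le> c l"
    using assms run_orthonormal run_in by (intro run_le) (auto simp: Bf.orthonormal_def)
  then show ?thesis using run_c[OF assms(2)] by simp
qed

text \<open>Replacing \<open>y l\<close> by \<open>- y l\<close> gives a competitor of value
  \<open>- c l\<close>.\<close>

lemma run_nonneg:
  assumes "l < p"
  shows "c l \<ge> 0"
proof -
  have "- y l \<in> F"
    using Bf.subspaceK_diff[OF Xp_subspace[OF F], of 0 "y l"] run_in(2)[OF assms] Xp_subspace[OF F]
    by (simp add: subspaceK_def)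
  then have "kre (\<B> (x l) (- y l)) \<le> c l"
    using assms run_orthonormal run_in
    by (intro run_le) (auto simp: Bf.orthonormal_def Bf.B.minus_right Bf.B.minus_left)
  then show ?thesis using run_c[OF assms] by (simp add: Bf.B.minus_right kre_minus)
qed

text \<open>If \<open>b = \<B> (x i) (y j)\<close> were nonzero, then the combination of \<open>y i\<close> and \<open>y j\<close> with
  coefficients \<open>c i\<close> and \<open>kconj b\<close> would, after normalisation, improve on the maximum \<open>c i\<close>.\<close>

lemma run_cross_orthogonal_less:
  assumes "i < j" "j < p"
  shows "\<B> (x i) (y j) = 0"
proof (rule ccontr)
  define b where "b = \<B> (x i) (y j)"
  assume "\<B> (x i) (y j) \<noteq> 0"
  then have "norm b > 0" by (simp add: b_def)
  define s where "s = (c i)\<^sup>2 + (norm b)\<^sup>2"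
  have "s > 0" using \<open>norm b > 0\<close> by (simp add: s_def add_nonneg_pos)
  define w where "w = ract (y i) (of_real (c i)) + ract (y j) (kconj b)"
  have ij: "i < p" using assms by simp
  have yy: "\<B> (y i) (y i) = 1" "\<B> (y j) (y j) = 1" "\<B> (y i) (y j) = 0" "\<B> (y j) (y i) = 0"
    using run_orthonormal(2) assms ij by (auto simp: Bf.orthonormal_def)
  have ww: "\<B> w w = of_real s"
    by (simp add: w_def Bf.B.add_left Bf.B.add_right Bf.B_ract_left Bf.B_ract_right yy kconj_kconj
        mult_kconj_self s_def power2_eq_square)
  have xw: "\<B> (x i) w = of_real s"
    by (simp add: w_def Bf.B.add_right Bf.B_ract_right run_c[OF ij] mult_kconj_self s_def
        power2_eq_square flip: b_def)
  \<comment> \<open>Both \<open>\<B> w w\<close> and \<open>\<B> (x i) w\<close> equal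
    \<open>s\<close>, so the normalised vector attains \<open>sqrt s\<close>, which exceeds
    \<open>c i\<close> because \<open>s = (c i)\<^sup>2 + (norm b)\<^sup>2\<close>.\<close>
  define v where "v = ract w (of_real (inverse (sqrt s)))"
  have "\<B> v v = 1"
    unfolding v_def Bf.B_self_ract ww norm_of_real kre_of_real using \<open>s > 0\<close>
    by (simp add: power_inverse)
  moreover have "v \<in> F"
    using run_in(2)[OF ij] run_in(2)[OF assms(2)] Xp_subspace[OF F]
    unfolding v_def w_def subspaceK_def by blast
  moreover have "\<B> (y k) v = 0" if "k < i" for k
    using that assms run_orthonormal(2)
    by (simp add: v_def w_def Bf.B_ract_right Bf.B.add_right Bf.orthonormal_def)
  ultimately have "kre (\<B> (x i) v) \<le> c i"
    using ij run_in(1)[OF ij] run_orthonormal(1) by (intro run_le) (auto simp: Bf.orthonormal_def)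
  moreover have "\<B> (x i) v = of_real (s * inverse (sqrt s))"
    unfolding v_def Bf.B_ract_right xw by (simp only: of_real_mult)
  moreover have "s * inverse (sqrt s) = sqrt s"
    using \<open>s > 0\<close> by (simp add: field_simps)
  ultimately have "sqrt s \<le> c i" by simp
  then have "s \<le> (c i)\<^sup>2" using run_nonneg[OF ij] \<open>s > 0\<close> by (metis real_sqrt_le_iff real_sqrt_unique)
  then show False using \<open>norm b > 0\<close> by (simp add: s_def)
qed

end

lemma run_cross_orthogonal:
  assumes "E \<in> Xp ract form E0 p" "F \<in> Xp ract form E0 p" "principal_run form E0 p E F x y c"
    and "i < p" "j < p" "i \<noteq> j"
  shows "\<B> (x i) (y j) = 0"
proof (cases "i < j")
  case True
  then show ?thesis using run_cross_orthogonal_less assms by blast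
next
  case False
  then have "\<B> (y j) (x i) = 0"
    using run_cross_orthogonal_less[OF assms(2,1) principal_run_sym[OF assms(3)], of j i] assms
    by simp
  then show ?thesis by (simp add: Bf.B_eq_zero_commute)
qed

section \<open>Residuals: the components of the \<open>y j\<close> orthogonal to
  \<open>E\<close>\<close>

lemma run_residual_orthogonal:
  assumes E: "E \<in> Xp ract form E0 p" and F: "F \<in> Xp ract form E0 p"
    and run: "principal_run form E0 p E F x y c" and "i < p" "j < p"
  shows "\<B> (x i) (y j - ract (x j) (of_real (c j))) = 0"
proof (cases "i = j")
  case True
  then show ?thesis
    using run_c[OF E F run \<open>j < p\<close>] run_orthonormal(1)[OF E F run] assms
    by (simp add: Bf.B.diff_right Bf.B_ract_right Bf.orthonormal_def)
next
  case False
  then show ?thesis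
    using run_cross_orthogonal[OF E F run, of i j] run_orthonormal(1)[OF E F run] assms
    by (simp add: Bf.B.diff_right Bf.B_ract_right Bf.orthonormal_def)
qed

lemma run_residual_orthogonal_E:
  assumes E: "E \<in> Xp ract form E0 p" and F: "F \<in> Xp ract form E0 p"
    and run: "principal_run form E0 p E F x y c" and "e \<in> E" "j < p"
  shows "\<B> e (y j - ract (x j) (of_real (c j))) = 0"
  by (subst run_expansion(1)[OF E F run \<open>e \<in> E\<close>])
    (simp add: Bf.B_comb_left run_residual_orthogonal[OF E F run _ \<open>j < p\<close>])

lemma run_residual_inner:
  assumes E: "E \<in> Xp ract form E0 p" and F: "F \<in> Xp ract form E0 p"
    and run: "principal_run form E0 p E F x y c" and "i < p" "j < p"
  shows "\<B> (y i - ract (x i) (of_real (c i))) (y j - ract (x j) (of_real (c j))) =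
    (if i = j then of_real (1 - (c i)\<^sup>2) else 0)"
proof -
  let ?w = "\<lambda>j. y j - ract (x j) (of_real (c j))"
  have "\<B> (y i - ract (x i) (of_real (c i))) (?w j) = \<B> (y i) (?w j)"
    using run_residual_orthogonal[OF E F run \<open>i < p\<close> \<open>j < p\<close>]
    by (simp only: Bf.B.diff_left Bf.B_ract_left) simp
  also have "\<dots> = \<B> (y i) (y j) - \<B> (y i) (x j) * of_real (c j)"
    by (simp add: Bf.B.diff_right Bf.B_ract_right)
  also have "\<dots> = (if i = j then of_real (1 - (c i)\<^sup>2) else 0)"
  proof (cases "i = j")
    case True
    have "\<B> (y j) (x j) = of_real (c j)"
      using run_c[OF F E principal_run_sym[OF run] \<open>j < p\<close>] .
    then show ?thesis
      using True run_orthonormal(2)[OF E F run] \<open>j < p\<close>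
      by (simp add: Bf.orthonormal_def power2_eq_square)
  next
    case False
    then have "\<B> (y i) (x j) = 0"
      using run_cross_orthogonal[OF F E principal_run_sym[OF run] \<open>i < p\<close> \<open>j < p\<close>] by simp
    then show ?thesis
      using False run_orthonormal(2)[OF E F run] assms by (simp add: Bf.orthonormal_def)
  qed
  finally show ?thesis .
qed

text \<open>The residual lies in the negative definite orthogonal of \<open>E\<close>, while its
  square \<open>1 - (c l)\<^sup>2\<close> is nonnegative for \<open>0 \<le> c l \<le> 1\<close>. The
  hypothesis is an inequality because the case \<open>c l < 1\<close> has yet to be refuted with its
  help.\<close>

lemma run_residual_eq_0:
  assumes E: "E \<in> Xp ract form E0 p" and F: "F \<in> Xp ract form E0 p"
    and run: "principal_run form E0 p E F x y c" and "l < p" and "c l \<le> 1"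
  shows "y l - ract (x l) (of_real (c l)) = 0"
proof (rule ccontr)
  assume "y l - ract (x l) (of_real (c l)) \<noteq> 0"
  then have "kre (\<B> (y l - ract (x l) (of_real (c l))) (y l - ract (x l) (of_real (c l)))) < 0"
    using Xp_orthogonal_negative[OF E] run_residual_orthogonal_E[OF E F run _ \<open>l < p\<close>] by blast
  then have "1 - (c l)\<^sup>2 < 0"
    unfolding run_residual_inner[OF E F run \<open>l < p\<close> \<open>l < p\<close>] by (simp only: kre_of_real if_True refl)
  moreover have "(c l)\<^sup>2 \<le> 1"
    using \<open>c l \<le> 1\<close> run_nonneg[OF E F run \<open>l < p\<close>] by (simp add: power_le_one)
  ultimately show False by simp
qed

text \<open>A reversed Cauchy-Schwarz inequality: for \<open>c l < 1\<close> the residual vanishes,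
  so its square \<open>1 - (c l)\<^sup>2\<close> is \<open>0\<close>, which is impossible.\<close>

lemma run_ge_1:
  assumes E: "E \<in> Xp ract form E0 p" and F: "F \<in> Xp ract form E0 p"
    and run: "principal_run form E0 p E F x y c" and l: "l < p"
  shows "c l \<ge> 1"
proof (rule ccontr)
  assume "\<not> c l \<ge> 1"
  then have c: "c l < 1" by simp
  then have "of_real (1 - (c l)\<^sup>2) = (0 :: 'k)"
    using run_residual_inner[OF E F run l l] run_residual_eq_0[OF E F run l]
    by (simp add: Bf.B.zero_left)
  then have "(c l)\<^sup>2 = 1" by (simp add: of_real_eq_0_iff del: of_real_diff of_real_power)
  with c run_nonneg[OF E F run l] show False by (simp add: power2_eq_1_iff)
qed

text \<open>The argument of Courant and Fischer: by a dimension count some nonzero combination \<open>u\<close> of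
  \<open>x' 0, \<dots>, x' l\<close> is orthogonal to \<open>x 0, \<dots>, x (l - 1)\<close>. With \<open>v\<close> the same combination of the
  \<open>y' j\<close>, the number \<open>\<B> u v\<close> is at least \<open>c' l * \<B> u u\<close> and at most \<open>c l * \<B> u u\<close>.\<close>

lemma run_le_run:
  assumes E: "E \<in> Xp ract form E0 p" and F: "F \<in> Xp ract form E0 p"
    and run: "principal_run form E0 p E F x y c"
    and run': "principal_run form E0 p E F x' y' c'" and l: "l < p"
  shows "c' l \<le> c l"
proof -
  obtain a k where a: "k \<le> l" "a k \<noteq> 0" "\<And>i. i < l \<Longrightarrow> (\<Sum>j\<le>l. \<B> (x i) (x' j) * a j) = 0"
    using homogeneous_system_solution[of "{..<l}" "{..l}" "\<lambda>i j. \<B> (x i) (x' j)"] by auto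
  define u v where "u = (\<Sum>j\<le>l. ract (x' j) (a j))" and "v = (\<Sum>j\<le>l. ract (y' j) (a j))"
  define N where "N = (\<Sum>j\<le>l. (norm (a j))\<^sup>2)"
  have "(norm (a k))\<^sup>2 \<le> N" unfolding N_def using a(1) by (intro member_le_sum) auto
  moreover have "(norm (a k))\<^sup>2 > 0" using a(2) by simp
  ultimately have "N > 0" by linarith
  have sub: "{..l} \<subseteq> {..<p}" using l by auto
  have uu: "\<B> u u = of_real N" and vv: "\<B> v v = of_real N"
    unfolding u_def v_def N_def
    by (rule Bf.orthonormal_B_self_comb[OF _ sub], rule run_orthonormal[OF E F run'])+
  have uE: "u \<in> E" and vF: "v \<in> F"
    unfolding u_def v_def
    using run_in[OF E F run'] l by (auto intro!: Bf.subspaceK_comb Xp_subspace E F)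
  have "\<B> u v = (\<Sum>j\<le>l. kconj (a j) * \<B> (x' j) (y' j) * a j)"
    unfolding u_def v_def using run_cross_orthogonal[OF E F run'] l
    by (intro Bf.B_comb_biorthogonal) auto
  also have "\<dots> = of_real (\<Sum>j\<le>l. c' j * (norm (a j))\<^sup>2)"
    unfolding of_real_sum
  proof (intro sum.cong refl)
    fix j assume "j \<in> {..l}"
    then have "kconj (a j) * \<B> (x' j) (y' j) * a j = of_real (c' j) * (kconj (a j) * a j)"
      using run_c[OF E F run', of j] l by (simp add: of_real_def)
    then show "kconj (a j) * \<B> (x' j) (y' j) * a j = of_real (c' j * (norm (a j))\<^sup>2)"
      by (simp only: kconj_mult_self_of_real of_real_mult)
  qed
  finally have "kre (\<B> u v) = (\<Sum>j\<le>l. c' j * (norm (a j))\<^sup>2)" by (simp only: kre_of_real)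
  moreover have "c' l * N \<le> (\<Sum>j\<le>l. c' j * (norm (a j))\<^sup>2)"
    unfolding N_def sum_distrib_left
    using run_antitone[OF E F run' _ l] by (intro sum_mono mult_right_mono) auto
  ultimately have lower: "c' l * N \<le> kre (\<B> u v)" by simp
  \<comment> \<open>Coordinates of \<open>u\<close> and \<open>v\<close> in the unprimed run. Only
    \<open>u\<close> is orthogonal to the earlier vectors; this suffices, because \<B> pairs the
    coordinates diagonally and a vanishing \<open>b i\<close> removes \<open>d i\<close> as
    well.\<close>
  define b d where "b i = \<B> (x i) u" and "d i = \<B> (y i) v" for i
  have b0: "b i = 0" if "i < l" for i
    using a(3)[OF that] by (simp add: b_def u_def Bf.B_comb_right)
  have ub: "u = (\<Sum>i<p. ract (x i) (b i))" and vd: "v = (\<Sum>i<p. ract (y i) (d i))"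
    unfolding b_def d_def by (rule run_expansion[OF E F run] uE vF)+
  have Nb: "N = (\<Sum>i<p. (norm (b i))\<^sup>2)" and Nd: "N = (\<Sum>i<p. (norm (d i))\<^sup>2)"
    using uu vv Bf.orthonormal_B_self_comb[OF run_orthonormal(1)[OF E F run] order_refl, of b]
      Bf.orthonormal_B_self_comb[OF run_orthonormal(2)[OF E F run] order_refl, of d]
    unfolding ub[symmetric] vd[symmetric] by (simp_all only: of_real_eq_iff)
  have "\<B> u v = (\<Sum>i<p. kconj (b i) * \<B> (x i) (y i) * d i)"
    by (subst ub, subst vd, intro Bf.B_comb_biorthogonal)
      (use run_cross_orthogonal[OF E F run] in auto)
  then have "norm (\<B> u v) \<le> (\<Sum>i<p. norm (kconj (b i) * \<B> (x i) (y i) * d i))"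
    by (simp only: norm_sum)
  \<comment> \<open>The product of norms is bounded by the mean of their squares; this costs nothing
    in the end, since the squares of the \<open>b i\<close> and of the \<open>d i\<close> both sum
    to \<open>N\<close>.\<close>
  also have "\<dots> \<le> (\<Sum>i<p. c l * (((norm (b i))\<^sup>2 + (norm (d i))\<^sup>2) / 2))"
  proof (intro sum_mono)
    fix i assume i: "i \<in> {..<p}"
    show "norm (kconj (b i) * \<B> (x i) (y i) * d i) \<le> c l * (((norm (b i))\<^sup>2 + (norm (d i))\<^sup>2) / 2)"
    proof (cases "i < l")
      case True
      then show ?thesis using b0 run_nonneg[OF E F run l] by simp
    next
      case False
      have "norm (kconj (b i) * \<B> (x i) (y i) * d i) = c i * (norm (b i) * norm (d i))"
        using i run_c[OF E F run, of i] run_nonneg[OF E F run, of i] by (simp add: norm_mult)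
      also have "\<dots> \<le> c l * (norm (b i) * norm (d i))"
        using i False run_antitone[OF E F run, of l i] by (intro mult_right_mono) auto
      also have "\<dots> \<le> c l * (((norm (b i))\<^sup>2 + (norm (d i))\<^sup>2) / 2)"
        using sum_squares_bound[of "norm (b i)" "norm (d i)"] run_nonneg[OF E F run l]
        by (intro mult_left_mono) auto
      finally show ?thesis .
    qed
  qed
  also have "\<dots> = c l * ((N + N) / 2)"
    by (subst Nb, subst Nd) (simp only: sum.distrib flip: sum_distrib_left sum_divide_distrib)
  also have "\<dots> = c l * N" by simp
  finally have "c' l * N \<le> c l * N"
    using lower kre_le_norm[of "\<B> u v"] by linarith
  then show ?thesis using \<open>N > 0\<close> by simp
qed

text \<open>Comparing two runs in both directions shows that their numbers agree, so
  \<open>THE\<close> may be evaluated on any run.\<close>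

lemma hyp_principal_angles_eq:
  assumes "E \<in> Xp ract form E0 p" "F \<in> Xp ract form E0 p" "principal_run form E0 p E F x y c"
  shows "hyp_principal_angles form E0 p E F = map (\<lambda>l. arcosh (c l)) [0..<p]"
  unfolding hyp_principal_angles_def
proof (rule the_equality)
  fix as
  assume "\<exists>x y c. principal_run form E0 p E F x y c \<and> as = map (\<lambda>l. arcosh (c l)) [0..<p]"
  then obtain x' y' c' where run': "principal_run form E0 p E F x' y' c'"
    and as: "as = map (\<lambda>l. arcosh (c' l)) [0..<p]" by blast
  have "c' l = c l" if "l < p" for l
    using run_le_run[OF assms run' that] run_le_run[OF assms(1,2) run' assms(3) that] by simp
  then show "as = map (\<lambda>l. arcosh (c l)) [0..<p]" by (simp add: as)
qed (use assms in blast)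

section \<open>The orbit criterion\<close>

lemma isometry_image_eq:
  assumes g: "g \<in> Bf.isometries" and E: "subspaceK ract E" and E': "subspaceK ract E'"
    and x: "\<And>i. i < n \<Longrightarrow> x i \<in> E" "\<And>u. u \<in> E \<Longrightarrow> u = (\<Sum>i<n. ract (x i) (\<B> (x i) u))"
    and x': "\<And>i. i < n \<Longrightarrow> x' i \<in> E'" "\<And>u. u \<in> E' \<Longrightarrow> u = (\<Sum>i<n. ract (x' i) (\<B> (x' i) u))"
    and gx: "\<And>i. i < n \<Longrightarrow> g (x i) = x' i"
  shows "g ` E = E'"
proof -
  have comb: "g (\<Sum>i<n. ract (x i) (a i)) = (\<Sum>i<n. ract (x' i) (a i))" for a
    by (simp add: Bf.bounded_linearK_comb[OF Bf.isometries_linearK[OF g]] gx)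
  show ?thesis
  proof (intro equalityI subsetI)
    fix v assume "v \<in> g ` E"
    then obtain u where "u \<in> E" "v = g u" by blast
    then have "v = (\<Sum>i<n. ract (x' i) (\<B> (x i) u))" using x(2) comb by metis
    then show "v \<in> E'" using x'(1) by (auto intro!: Bf.subspaceK_comb[OF E'])
  next
    fix v assume "v \<in> E'"
    then have "v = g (\<Sum>i<n. ract (x i) (\<B> (x' i) v))" using x'(2) comb by metis
    moreover have "(\<Sum>i<n. ract (x i) (\<B> (x' i) v)) \<in> E"
      using x(1) by (auto intro!: Bf.subspaceK_comb[OF E])
    ultimately show "v \<in> g ` E" by blast
  qed
qed

lemma pair_orbit_iff_angles:
  assumes E: "E \<in> Xp ract form E0 p" and F: "F \<in> Xp ract form E0 p"
    and E': "E' \<in> Xp ract form E0 p" and F': "F' \<in> Xp ract form E0 p"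
  shows "(\<exists>g\<in>Op_inf ract form E0. g ` E = E' \<and> g ` F = F') \<longleftrightarrow>
    hyp_principal_angles form E0 p E F = hyp_principal_angles form E0 p E' F'"
proof
  assume "\<exists>g\<in>Op_inf ract form E0. g ` E = E' \<and> g ` F = F'"
  then obtain g where g: "g \<in> Bf.isometries" "g ` E = E'" "g ` F = F'"
    by (auto simp: Op_inf_eq_isometries)
  obtain x y c where run: "principal_run form E0 p E F x y c"
    using principal_run_exists[OF E F] by blast
  then have "principal_run form E0 p E' F' (g \<circ> x) (g \<circ> y) c"
    using principal_run_image[OF g(1) run] g by simp
  then show "hyp_principal_angles form E0 p E F = hyp_principal_angles form E0 p E' F'"
    using run hyp_principal_angles_eq E F E' F' by simp
next
  assume eq: "hyp_principal_angles form E0 p E F = hyp_principal_angles form E0 p E' F'"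
  obtain x y c where run: "principal_run form E0 p E F x y c"
    using principal_run_exists[OF E F] by blast
  obtain x' y' c' where run': "principal_run form E0 p E' F' x' y' c'"
    using principal_run_exists[OF E' F'] by blast
  have cc: "c l = c' l" if l: "l < p" for l
  proof -
    have "map (\<lambda>l. arcosh (c l)) [0..<p] = map (\<lambda>l. arcosh (c' l)) [0..<p]"
      using eq hyp_principal_angles_eq[OF E F run] hyp_principal_angles_eq[OF E' F' run'] by simp
    then have "arcosh (c l) = arcosh (c' l)"
      using l by (simp add: map_eq_conv)
    then have "cosh (arcosh (c l)) = cosh (arcosh (c' l))" by simp
    then show ?thesis
      using run_ge_1[OF E F run l] run_ge_1[OF E' F' run' l] by (simp add: cosh_arcosh_real)
  qed
  let ?w = "\<lambda>i. y i - ract (x i) (of_real (c i))"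
  let ?w' = "\<lambda>i. y' i - ract (x' i) (of_real (c' i))"
  define f where "f i = (if i < p then x i else ?w (i - p))" for i
  define f' where "f' i = (if i < p then x' i else ?w' (i - p))" for i
  \<comment> \<open>The common Gram matrix of both families, written with the numbers
    \<open>c\<close> of the first pair alone. The families have length \<open>2 * p\<close> whatever
    the dimension of \<open>E + F\<close>, with vanishing residuals kept as zero vectors.\<close>
  define q :: "nat \<Rightarrow> nat \<Rightarrow> 'k" where
    "q i j = (if i = j then if i < p then 1 else of_real (1 - (c (i - p))\<^sup>2) else 0)" for i j
  have gram: "\<B> (g i) (g j) = q i j"
    if "E \<in> Xp ract form E0 p" "F \<in> Xp ract form E0 p" "principal_run form E0 p E F x y d"
      "i < 2 * p" "j < 2 * p" "\<And>l. l < p \<Longrightarrow> c l = d l"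
      and g: "g = (\<lambda>i. if i < p then x i else y (i - p) - ract (x (i - p)) (of_real (d (i - p))))"
    for E F x y d g i j
  proof -
    note res = run_residual_orthogonal[OF that(1-3)] run_residual_inner[OF that(1-3)]
    have res': "\<B> (y l - ract (x l) (of_real (d l))) (x k) = 0" if "l < p" "k < p" for l k
      using res(1)[OF that(2,1)] by (simp add: Bf.B_eq_zero_commute)
    have *: "i - p = j - p \<longleftrightarrow> i = j" if "i \<ge> p" "j \<ge> p" using that by auto
    show ?thesis
      using run_orthonormal(1)[OF that(1-3)] that(4-6)
      by (cases "i < p"; cases "j < p")
        (auto simp: g q_def res res' * Bf.orthonormal_def)
  qed
  have ff: "\<B> (f i) (f j) = q i j" if "i < 2 * p" "j < 2 * p" for i j
    using gram[OF E F run that, of f] by (simp add: f_def[abs_def])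
  have ff': "\<B> (f' i) (f' j) = q i j" if "i < 2 * p" "j < 2 * p" for i j
    using gram[OF E' F' run' that, of f'] cc by (simp add: f'_def[abs_def])
  have "\<exists>g\<in>Bf.isometries. \<forall>i<2 * p. g (f i) = f' i"
  proof (rule Bf.exists_isometry_orthogonal_families)
    fix i j assume "i < 2 * p" "j < 2 * p" "i \<noteq> j"
    then show "\<B> (f i) (f j) = 0" "\<B> (f' i) (f' j) = 0"
      by (simp_all add: ff ff' q_def)
  next
    fix i assume i: "i < 2 * p"
    then show "\<B> (f i) (f i) = \<B> (f' i) (f' i)" by (simp add: ff ff')
    assume "\<B> (f i) (f i) = 0"
    then have "q i i = 0" using i by (simp add: ff)
    \<comment> \<open>A zero on the diagonal can only come from a residual, and there it means
      \<open>c = 1\<close>, so that the residual vanishes for both pairs.\<close>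
    then have ip: "i \<ge> p" by (auto simp: q_def split: if_splits)
    with \<open>q i i = 0\<close> have "of_real (1 - (c (i - p))\<^sup>2) = (0 :: 'k)" by (simp add: q_def)
    then have "(c (i - p))\<^sup>2 = 1" by (simp add: of_real_eq_0_iff del: of_real_diff of_real_power)
    moreover have l: "i - p < p" using i ip by simp
    ultimately have "c (i - p) \<le> 1"
      using run_nonneg[OF E F run l] by (simp add: power2_eq_1_iff)
    then show "f i = 0 \<and> f' i = 0"
      using run_residual_eq_0[OF E F run l] run_residual_eq_0[OF E' F' run' l] cc[OF l] ip
      by (simp add: f_def f'_def)
  qed
  then obtain g where g: "g \<in> Bf.isometries" and gf: "\<And>i. i < 2 * p \<Longrightarrow> g (f i) = f' i"
    by blast
  have gx: "g (x i) = x' i" if "i < p" for i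
    using gf[of i] that by (simp add: f_def f'_def)
  have lin: "bounded_linear g" "\<And>u a. g (ract u a) = ract (g u) a"
    using Bf.isometries_linearK[OF g] by (simp_all add: bounded_linearK_def)
  \<comment> \<open>\<open>y i\<close> is recovered as its residual plus \<open>x i c i\<close>, and
    \<open>g\<close> matches both summands.\<close>
  have gy: "g (y i) = y' i" if i: "i < p" for i
  proof -
    have "g (?w i) = ?w' i"
      using gf[of "p + i"] i by (simp add: f_def f'_def)
    moreover have "g (?w i) = g (y i) - ract (x' i) (of_real (c' i))"
      using i by (simp add: linear_simps[OF lin(1)] lin(2) gx cc)
    ultimately show ?thesis by simp
  qed
  have "g ` E = E'"
    using isometry_image_eq[OF g Xp_subspace[OF E] Xp_subspace[OF E'] run_in(1)[OF E F run]
        run_expansion(1)[OF E F run] run_in(1)[OF E' F' run'] run_expansion(1)[OF E' F' run'] gx] .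
  moreover have "g ` F = F'"
    using isometry_image_eq[OF g Xp_subspace[OF F] Xp_subspace[OF F'] run_in(2)[OF E F run]
        run_expansion(2)[OF E F run] run_in(2)[OF E' F' run'] run_expansion(2)[OF E' F' run'] gy] .
  ultimately show "\<exists>g\<in>Op_inf ract form E0. g ` E = E' \<and> g ` F = F'"
    using g by (auto simp: Op_inf_eq_isometries)
qed

end

text \<open>Proved once for an arbitrary scalar type of the class; the real, complex and
  quaternionic cases are instances.\<close>

lemma orbits_determined_by_angles:
  fixes ract :: "'h::banach \<Rightarrow> 'k::hilbert_scalar \<Rightarrow> 'h"
  assumes "separable_inf_dim_right_hilbert_space ract form \<and> has_dimK ract E0 p"
  shows "\<forall>E\<in>Xp ract form E0 p. \<forall>F\<in>Xp ract form E0 p.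
    \<forall>E'\<in>Xp ract form E0 p. \<forall>F'\<in>Xp ract form E0 p.
      (\<exists>g\<in>Op_inf ract form E0. g ` E = E' \<and> g ` F = F') \<longleftrightarrow>
      hyp_principal_angles form E0 p E F = hyp_principal_angles form E0 p E' F'"
proof -
  interpret separable_inf_dim_right_hilbert_space ract form using assms by blast
  interpret signature_space ract form E0 p by unfold_locales (use assms in blast)
  show ?thesis by (intro ballI pair_orbit_iff_angles)
qed

theorem proposition3p3:
  fixes p :: nat
  assumes "p > 0"
  shows
    "(\<forall>(ract :: 'r::banach \<Rightarrow> real \<Rightarrow> 'r) form E0.
        separable_inf_dim_right_hilbert_space ract form \<and> has_dimK ract E0 p \<longrightarrow>
        (\<forall>E\<in>Xp ract form E0 p. \<forall>F\<in>Xp ract form E0 p.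
         \<forall>E'\<in>Xp ract form E0 p. \<forall>F'\<in>Xp ract form E0 p.
           (\<exists>g\<in>Op_inf ract form E0. g ` E = E' \<and> g ` F = F') \<longleftrightarrow>
           hyp_principal_angles form E0 p E F = hyp_principal_angles form E0 p E' F')) \<and>
     (\<forall>(ract :: 'c::banach \<Rightarrow> complex \<Rightarrow> 'c) form E0.
        separable_inf_dim_right_hilbert_space ract form \<and> has_dimK ract E0 p \<longrightarrow>
        (\<forall>E\<in>Xp ract form E0 p. \<forall>F\<in>Xp ract form E0 p.
         \<forall>E'\<in>Xp ract form E0 p. \<forall>F'\<in>Xp ract form E0 p.
           (\<exists>g\<in>Op_inf ract form E0. g ` E = E' \<and> g ` F = F') \<longleftrightarrow>
           hyp_principal_angles form E0 p E F = hyp_principal_angles form E0 p E' F')) \<and>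
     (\<forall>(ract :: 'h::banach \<Rightarrow> quat \<Rightarrow> 'h) form E0.
        separable_inf_dim_right_hilbert_space ract form \<and> has_dimK ract E0 p \<longrightarrow>
        (\<forall>E\<in>Xp ract form E0 p. \<forall>F\<in>Xp ract form E0 p.
         \<forall>E'\<in>Xp ract form E0 p. \<forall>F'\<in>Xp ract form E0 p.
           (\<exists>g\<in>Op_inf ract form E0. g ` E = E' \<and> g ` F = F') \<longleftrightarrow>
           hyp_principal_angles form E0 p E F = hyp_principal_angles form E0 p E' F'))"
  by (intro conjI allI impI; rule orbits_determined_by_angles; assumption)

end
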